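(* If $G$ is a BK-free line graph (of a multigraph) with $\omega(G)<\Delta(G)$, then $\Delta(G)<69$. Consequently, if $G$ is a line graph with $\Delta(G)\ge 69$, then $\chi_{OL}(G)\le\max\{\omega(G),\Delta(G)-1\}$.
   Context: The line graph of a loopless multigraph $H$ has vertex set $E(H)$, two vertices adjacent when the corresponding edges share an endpoint. For $f:V(G)\to\mathbb{Z}^+$, $G$ is $f$-paintable if Painter has a winning strategy in the game where each vertex $v$ starts with $f(v)$ tokens; each round Lister chooses a nonempty set $M$ of uncolored vertices and removes one token from each, then Painter colors (removes) an independent set $I\subseteq M$; Lister wins if some uncolored vertex runs out of tokens, Painter wins if all vertices get colored. $\chi_{OL}(G)$ is the least $k$ with $G$ $f$-paintable for $f\equiv k$. For a graph $G$ and $f:V(G)\to\mathbb{Z}^+$, an orientation $D$ of $E(G)$ is an Alon--Tarsi orientation for $f$ if $d^+_D(v)<f(v)$ for every vertex $v$ and the number of spanning Eulerian subgraphs of $D$ (spanning subdigraphs in which every vertex has equal in- and out-degree) with an even number of edges differs from the number with an odd number of edges; $G$ is $f$-AT if such an orientation exists. A digraph (in which some edges may be oriented in both directions) is kernel-perfect if every induced subdigraph $D'$ has a kernel, i.e., a set $I\subseteq V(D')$ with no arc between two of its vertices such that every vertex of $D'$ not in $I$ has an out-neighbor in $I$. A graph $H$ is $f$-KP if some supergraph $H'$ of $H$ on the same vertex set (possibly with parallel edges) has a kernel-perfect orientation with $d^+(v)<f(v)$ for all $v$. A connected graph $G$ is BK-free if it has no induced subgraph $H$ that is $f_H$-AT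 or $f_H$-KP, where $f_H(v)=d_H(v)-1+\Delta(G)-d_G(v)$ for $v\in V(H)$. *)

theory Defs
  imports Main
begin

definition graph :: "'a set \<Rightarrow> ('a \<Rightarrow> 'a \<Rightarrow> bool) \<Rightarrow> bool" where
  "graph V adj \<longleftrightarrow> finite V \<and>
     (\<forall>u v. adj u v \<longrightarrow> u \<in> V \<and> v \<in> V \<and> u \<noteq> v \<and> adj v u)"

definition deg :: "'a set \<Rightarrow> ('a \<Rightarrow> 'a \<Rightarrow> bool) \<Rightarrow> 'a \<Rightarrow> nat" where
  "deg V adj v = card {u \<in> V. adj v u}"

definition maxdeg :: "'a set \<Rightarrow> ('a \<Rightarrow> 'a \<Rightarrow> bool) \<Rightarrow> nat" where
  "maxdeg V adj = (if V = {} then 0 else Max (deg V adj ` V))"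

definition is_clique :: "('a \<Rightarrow> 'a \<Rightarrow> bool) \<Rightarrow> 'a set \<Rightarrow> bool" where
  "is_clique adj K \<longleftrightarrow> (\<forall>u\<in>K. \<forall>v\<in>K. u \<noteq> v \<longrightarrow> adj u v)"

definition clique_number :: "'a set \<Rightarrow> ('a \<Rightarrow> 'a \<Rightarrow> bool) \<Rightarrow> nat" where
  "clique_number V adj = Max {card K | K. K \<subseteq> V \<and> is_clique adj K}"

definition independent :: "('a \<Rightarrow> 'a \<Rightarrow> bool) \<Rightarrow> 'a set \<Rightarrow> bool" where
  "independent adj I \<longleftrightarrow> (\<forall>u\<in>I. \<forall>v\<in>I. \<not> adj u v)"

definition connected_graph :: "'a set \<Rightarrow> ('a \<Rightarrow> 'a \<Rightarrow> bool) \<Rightarrow> bool" where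
  "connected_graph V adj \<longleftrightarrow> V \<noteq> {} \<and> (\<forall>u\<in>V. \<forall>v\<in>V. adj\<^sup>*\<^sup>* u v)"

definition induced :: "('a \<Rightarrow> 'a \<Rightarrow> bool) \<Rightarrow> 'a set \<Rightarrow> 'a \<Rightarrow> 'a \<Rightarrow> bool" where
  "induced adj S = (\<lambda>u v. u \<in> S \<and> v \<in> S \<and> adj u v)"

text \<open>G is the line graph of a loopless multigraph H: the edges of H are the
vertices of G, each with a 2-element set of endpoints (vertices of H, labelled
by naturals); distinct vertices of G are adjacent iff the edges share an endpoint.\<close>
definition line_graph :: "'a set \<Rightarrow> ('a \<Rightarrow> 'a \<Rightarrow> bool) \<Rightarrow> bool" where
  "line_graph V adj \<longleftrightarrow> (\<exists>ends :: 'a \<Rightarrow> nat set.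
      (\<forall>v\<in>V. card (ends v) = 2) \<and>
      (\<forall>u\<in>V. \<forall>v\<in>V. u \<noteq> v \<longrightarrow> (adj u v \<longleftrightarrow> ends u \<inter> ends v \<noteq> {})))"

text \<open>painter_win adj U g: Painter wins from the position where U is the set of
uncoloured vertices and g gives the remaining tokens.\<close>
inductive painter_win :: "('a \<Rightarrow> 'a \<Rightarrow> bool) \<Rightarrow> 'a set \<Rightarrow> ('a \<Rightarrow> nat) \<Rightarrow> bool"
  for adj where
  pw_done: "U = {} \<Longrightarrow> painter_win adj U g"
| pw_step: "U \<noteq> {} \<Longrightarrow>
     (\<forall>M. M \<noteq> {} \<and> M \<subseteq> U \<longrightarrow>
        (\<exists>I. I \<subseteq> M \<and> independent adj I \<and>
             (\<forall>u\<in>U - I. (if u \<in> M then g u - 1 else g u) > 0) \<and>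
             painter_win adj (U - I) (\<lambda>u. if u \<in> M then g u - 1 else g u)))
     \<Longrightarrow> painter_win adj U g"

definition paintable :: "'a set \<Rightarrow> ('a \<Rightarrow> 'a \<Rightarrow> bool) \<Rightarrow> ('a \<Rightarrow> nat) \<Rightarrow> bool" where
  "paintable V adj f \<longleftrightarrow> (\<forall>v\<in>V. f v \<ge> 1) \<and> painter_win adj V f"

definition chi_OL :: "'a set \<Rightarrow> ('a \<Rightarrow> 'a \<Rightarrow> bool) \<Rightarrow> nat" where
  "chi_OL V adj = (LEAST k. k \<ge> 1 \<and> paintable V adj (\<lambda>_. k))"

definition orientation :: "('a \<Rightarrow> 'a \<Rightarrow> bool) \<Rightarrow> ('a \<times> 'a) set \<Rightarrow> bool" where
  "orientation adj D \<longleftrightarrow> D \<subseteq> {(u, v). adj u v} \<and>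
     (\<forall>u v. adj u v \<longrightarrow> ((u, v) \<in> D \<longleftrightarrow> (v, u) \<notin> D))"

definition outdeg :: "('a \<times> 'a) set \<Rightarrow> 'a \<Rightarrow> nat" where
  "outdeg D v = card {w. (v, w) \<in> D}"

definition eulerian_sub :: "('a \<times> 'a) set \<Rightarrow> ('a \<times> 'a) set \<Rightarrow> bool" where
  "eulerian_sub D A \<longleftrightarrow> A \<subseteq> D \<and>
     (\<forall>v. card {w. (v, w) \<in> A} = card {w. (w, v) \<in> A})"

definition is_AT :: "'a set \<Rightarrow> ('a \<Rightarrow> 'a \<Rightarrow> bool) \<Rightarrow> ('a \<Rightarrow> int) \<Rightarrow> bool" where
  "is_AT V adj f \<longleftrightarrow> (\<exists>D. orientation adj D \<and>
     (\<forall>v\<in>V. int (outdeg D v) < f v) \<and>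
     card {A. eulerian_sub D A \<and> even (card A)} \<noteq>
     card {A. eulerian_sub D A \<and> odd (card A)})"

text \<open>A digraph on V possibly with parallel arcs: D u v is the number of arcs
from u to v.  Kernels only depend on the existence of arcs.\<close>
definition has_kernel :: "('a \<Rightarrow> 'a \<Rightarrow> nat) \<Rightarrow> 'a set \<Rightarrow> bool" where
  "has_kernel D S \<longleftrightarrow> (\<exists>I. I \<subseteq> S \<and> (\<forall>x\<in>I. \<forall>y\<in>I. D x y = 0) \<and>
     (\<forall>x\<in>S - I. \<exists>y\<in>I. D x y > 0))"

definition kernel_perfect :: "'a set \<Rightarrow> ('a \<Rightarrow> 'a \<Rightarrow> nat) \<Rightarrow> bool" where
  "kernel_perfect V D \<longleftrightarrow> (\<forall>S. S \<subseteq> V \<longrightarrow> has_kernel D S)"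

text \<open>H is f-KP: some loopless multigraph H' on V(H) containing all edges of H
(edge multiplicity between u and v is D u v + D v u) has an orientation D which
is kernel-perfect with outdegrees below f.\<close>
definition is_KP :: "'a set \<Rightarrow> ('a \<Rightarrow> 'a \<Rightarrow> bool) \<Rightarrow> ('a \<Rightarrow> int) \<Rightarrow> bool" where
  "is_KP V adj f \<longleftrightarrow> (\<exists>D :: 'a \<Rightarrow> 'a \<Rightarrow> nat.
     (\<forall>u v. D u v > 0 \<longrightarrow> u \<in> V \<and> v \<in> V \<and> u \<noteq> v) \<and>
     (\<forall>u v. adj u v \<longrightarrow> D u v + D v u > 0) \<and>
     kernel_perfect V D \<and>
     (\<forall>v\<in>V. int (\<Sum>w\<in>V. D v w) < f v))"

definition fH :: "'a set \<Rightarrow> ('a \<Rightarrow> 'a \<Rightarrow> bool) \<Rightarrow> 'a set \<Rightarrow> 'a \<Rightarrow> int" where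
  "fH V adj S v = int (deg S (induced adj S) v) - 1 + int (maxdeg V adj) - int (deg V adj v)"

definition BK_free :: "'a set \<Rightarrow> ('a \<Rightarrow> 'a \<Rightarrow> bool) \<Rightarrow> bool" where
  "BK_free V adj \<longleftrightarrow> connected_graph V adj \<and>
     \<not> (\<exists>S. S \<subseteq> V \<and> S \<noteq> {} \<and>
          (is_AT S (induced adj S) (fH V adj S) \<or> is_KP S (induced adj S) (fH V adj S)))"

end

theory Submission
  imports Defs
begin

text \<open>Write k for the number of colours, \<open>k = \<Delta> - 1\<close> for the first claim and
  \<open>k = max \<omega> (\<Delta> - 1)\<close> for the second.  Both claims follow from one statement: a nonempty line
  graph with cliques of size at most k, degrees at most \<open>k + 1\<close> and \<open>k \<ge> 68\<close> has a nonempty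
  induced subgraph S that is f-AT or f-KP for \<open>f(v) = d_S(v) + k - d(v)\<close>.  For the second claim,
  S is removed and Painter wins on the rest by induction; a vertex of S loses a neighbour outside S
  whenever it loses a token to it, so that a winning reply within S remains possible.  For f-AT
  graphs the reply comes from the coefficient \<open>\<Sum> (-1)^|A|\<close> of the graph polynomial.

  Let H be the multigraph, so \<open>d_H(x) \<le> k\<close>, and suppose there is no such S.  Then all degrees are k
  or \<open>k + 1\<close>, and \<open>d_H(x) + d_H(y) \<ge> k + 1 + \<mu>(xy)\<close> for every edge xy.  Preferences at the vertices
  of a bipartite subgraph of H orient its line graph, and stable matchings are kernels; it
  suffices that every edge is preferred to at least two others each of which shares just one end
  with it (one other for an edge of degree k).  If \<open>\<mu>(vw) \<ge> 4\<close>, the clique bound yields two disjoint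
  nonadjacent pairs among the other edges at v and at w.  According to the edges between the
  pairs, part of the class of vw together with the four edges is bipartite, a
  \<open>K\<^sub>3\<close> joined to a \<open>P\<^sub>4\<close>, or a \<open>K\<^sub>2\<close> joined to a \<open>C\<^sub>4\<close>, and the latter two have
  Alon--Tarsi orientations.

  If \<open>\<mu> \<le> 3\<close>, let every vertex of a bipartite subgraph rank some edges lowest, no edge being
  chosen by both ends.  Four choices per vertex suffice, so that by Hall's theorem every vertex
  set W spans fewer than \<open>8|W|\<close> edges.  Vertices of degree at most 15 have only neighbours of
  degree at least 55, and the same argument with two choices per neighbour, at most one at each
  low vertex, shows that there are fewer than twice as many of them as of their neighbours.
  Counting the edges at the vertices of degree at least 16 is then contradictory.\<close>

section \<open>Signed counts of Eulerian subgraphs\<close>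

definition flow :: "('a \<times> 'a) set \<Rightarrow> 'a \<Rightarrow> int" where
  "flow A i = int (card {w. (i, w) \<in> A}) - int (card {w. (w, i) \<in> A})"

text \<open>Prescribing an arbitrary net outflow \<open>b\<close>, not only zero, is what allows a
  recursion on the arcs. For \<open>b = 0\<close> the value is the number of even minus the number
  of odd Eulerian subgraphs.\<close>

definition flow_sum :: "('a \<times> 'a) set \<Rightarrow> ('a \<Rightarrow> int) \<Rightarrow> int" where
  "flow_sum F b = (\<Sum>A\<in>Pow F. if flow A = b then (-1) ^ card A else 0)"

lemma eulerian_sub_iff_flow: "eulerian_sub D A \<longleftrightarrow> A \<subseteq> D \<and> flow A = (\<lambda>_. 0)"
  by (auto simp: eulerian_sub_def flow_def fun_eq_iff)

lemma finite_out: "finite A \<Longrightarrow> finite {w. (i, w) \<in> A}"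
  by (rule finite_subset[of _ "snd ` A"]) force+

lemma finite_in: "finite A \<Longrightarrow> finite {w. (w, i) \<in> A}"
  by (rule finite_subset[of _ "fst ` A"]) force+

lemma flow_insert:
  assumes "finite A" "(u, v) \<notin> A" "u \<noteq> v"
  shows "flow (insert (u, v) A) = (flow A)(u := flow A u + 1, v := flow A v - 1)"
proof
  fix i
  have o: "{w. (i, w) \<in> insert (u, v) A} = (if i = u then insert v {w. (i, w) \<in> A} else {w. (i, w) \<in> A})"
    by auto
  have n: "{w. (w, i) \<in> insert (u, v) A} = (if i = v then insert u {w. (w, i) \<in> A} else {w. (w, i) \<in> A})"
    by auto
  show "flow (insert (u, v) A) i = ((flow A)(u := flow A u + 1, v := flow A v - 1)) i"
    unfolding flow_def o n using assms finite_out[OF assms(1)] finite_in[OF assms(1)] by auto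
qed

lemma sum_Pow_insert:
  assumes "finite F" "x \<notin> F"
  shows "(\<Sum>A\<in>Pow (insert x F). g A) = (\<Sum>A\<in>Pow F. g A + (g (insert x A) :: 'b :: comm_monoid_add))"
proof -
  have "(\<Sum>A\<in>Pow (insert x F). g A) = (\<Sum>A\<in>Pow F. g A) + (\<Sum>A\<in>insert x ` Pow F. g A)"
    unfolding Pow_insert by (rule sum.union_disjoint) (use assms in auto)
  also have "(\<Sum>A\<in>insert x ` Pow F. g A) = (\<Sum>A\<in>Pow F. g (insert x A))"
    by (subst sum.reindex) (use assms in \<open>auto simp: inj_on_def\<close>)
  finally show ?thesis by (simp add: sum.distrib)
qed

text \<open>Subsets are split by whether they contain the new arc. Those that do have the opposite
  sign, and their other arcs must produce \<open>b\<close> without the contribution of that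
  arc.\<close>

lemma flow_sum_insert:
  assumes "finite F" "(u, v) \<notin> F" "u \<noteq> v"
  shows "flow_sum (insert (u, v) F) b = flow_sum F b - flow_sum F (b(u := b u - 1, v := b v + 1))"
proof -
  have "flow_sum (insert (u, v) F) b =
      (\<Sum>A\<in>Pow F. (if flow A = b then (-1) ^ card A else 0) +
                  (if flow (insert (u, v) A) = b then (-1) ^ card (insert (u, v) A) else 0))"
    unfolding flow_sum_def by (rule sum_Pow_insert) (use assms in auto)
  also have "\<dots> = (\<Sum>A\<in>Pow F. (if flow A = b then (-1) ^ card A else 0) -
                  (if flow A = b(u := b u - 1, v := b v + 1) then (-1) ^ card A else 0))"
  proof (rule sum.cong[OF refl])
    fix A assume "A \<in> Pow F"
    then have A: "finite A" "(u, v) \<notin> A" using assms finite_subset by auto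
    have "flow (insert (u, v) A) = b \<longleftrightarrow> flow A = b(u := b u - 1, v := b v + 1)"
      unfolding flow_insert[OF A assms(3)] using assms(3) by (auto simp: fun_eq_iff)
    then show "(if flow A = b then (-1) ^ card A else 0) +
        (if flow (insert (u, v) A) = b then (-1) ^ card (insert (u, v) A) else 0) =
        (if flow A = b then (-1) ^ card A else 0) -
        (if flow A = b(u := b u - 1, v := b v + 1) then (-1 :: int) ^ card A else 0)"
      using A by simp
  qed
  finally show ?thesis by (simp add: flow_sum_def sum_subtractf)
qed

text \<open>A vertex met by no arc is balanced in every subset; this justifies the cut-off in the
  evaluation below.\<close>

lemma flow_sum_isolated:
  assumes "\<forall>(u, v)\<in>F. u \<noteq> i \<and> v \<noteq> i" "b i \<noteq> 0"
  shows "flow_sum F b = 0"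
  unfolding flow_sum_def
proof (rule sum.neutral, intro ballI)
  fix A assume "A \<in> Pow F"
  then have "{w. (i, w) \<in> A} = {}" "{w. (w, i) \<in> A} = {}" using assms(1) by blast+
  then have "flow A i = 0" by (simp add: flow_def)
  then show "(if flow A = b then (-1) ^ card A else 0) = (0 :: int)" using assms(2) by auto
qed

text \<open>A branch is cut off as soon as a vertex that meets no remaining arc is unbalanced.\<close>
fun signed_count :: "(nat \<times> nat) list \<Rightarrow> int list \<Rightarrow> int" where
  "signed_count [] bs = (if list_all (\<lambda>b. b = 0) bs then 1 else 0)"
| "signed_count ((u, v) # xs) bs =
     (let cont = (\<lambda>cs. if list_ex (\<lambda>i. cs ! i \<noteq> 0 \<and> list_all (\<lambda>(a, b). a \<noteq> i \<and> b \<noteq> i) xs) [u, v]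
                      then 0 else signed_count xs cs)
      in cont bs - cont (bs[u := bs ! u - 1, v := bs ! v + 1]))"

text \<open>The list \<open>bs\<close> holds the outflow still to be produced at each vertex;
  vertices beyond its length must be balanced.\<close>

lemma signed_count_eq_flow_sum:
  assumes "distinct xs" "\<forall>(u, v)\<in>set xs. u < length bs \<and> v < length bs \<and> u \<noteq> v"
  shows "signed_count xs bs = flow_sum (set xs) (\<lambda>i. if i < length bs then bs ! i else 0)"
  using assms
proof (induction xs bs rule: signed_count.induct)
  case (1 bs)
  have "flow {} = (\<lambda>i. if i < length bs then bs ! i else 0) \<longleftrightarrow> list_all (\<lambda>b. b = 0) bs"
    by (auto simp: flow_def fun_eq_iff list_all_length)
  then show ?case by (simp add: flow_sum_def)
next
  case (2 u v xs bs)
  let ?b = "\<lambda>bs i. if i < length bs then bs ! i else (0 :: int)"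
  define cont where "cont = (\<lambda>cs. if list_ex (\<lambda>i. cs ! i \<noteq> 0 \<and> list_all (\<lambda>(a, b). a \<noteq> i \<and> b \<noteq> i) xs) [u, v]
                      then 0 else signed_count xs cs)"
  have uv: "u < length bs" "v < length bs" "u \<noteq> v" "(u, v) \<notin> set xs" "distinct xs"
    using 2 by auto
  have cont: "cont cs = flow_sum (set xs) (?b cs)" if "length cs = length bs" for cs
  proof (cases "list_ex (\<lambda>i. cs ! i \<noteq> 0 \<and> list_all (\<lambda>(a, b). a \<noteq> i \<and> b \<noteq> i) xs) [u, v]")
    case True
    then obtain i where "i \<in> {u, v}" "cs ! i \<noteq> 0" "\<forall>(a, b)\<in>set xs. a \<noteq> i \<and> b \<noteq> i"
      by (auto simp: list_all_iff)
    then have "flow_sum (set xs) (?b cs) = 0"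
      using uv that by (intro flow_sum_isolated[of _ i]) auto
    then show ?thesis using True by (simp add: cont_def)
  next
    case False
    have "signed_count xs cs = flow_sum (set xs) (?b cs)"
      using 2(1)[OF False] 2(3) that uv by auto
    then show ?thesis using False unfolding cont_def by (simp only: if_False)
  qed
  have "?b (bs[u := bs ! u - 1, v := bs ! v + 1]) = (?b bs)(u := ?b bs u - 1, v := ?b bs v + 1)"
    using uv by (auto simp: fun_eq_iff nth_list_update)
  moreover have "signed_count ((u, v) # xs) bs = cont bs - cont (bs[u := bs ! u - 1, v := bs ! v + 1])"
    by (simp add: cont_def Let_def)
  ultimately show ?case
    using flow_sum_insert[of "set xs" u v "?b bs"] uv by (simp add: cont)
qed

section \<open>Transfer of arc lists to graphs\<close>

lemma flow_image:
  assumes inj: "inj_on h N" and A: "A \<subseteq> N \<times> N" and i: "i \<in> N"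
  shows "flow (map_prod h h ` A) (h i) = flow A i"
proof -
  have *: "h a = h i \<longleftrightarrow> a = i" if "a \<in> N" for a
    using inj that i by (auto dest: inj_onD)
  have "{w. (h i, w) \<in> map_prod h h ` A} = h ` {w. (i, w) \<in> A}"
    using A * by force
  moreover have "{w. (w, h i) \<in> map_prod h h ` A} = h ` {w. (w, i) \<in> A}"
    using A * by force
  moreover have "inj_on h {w. (i, w) \<in> A}" "inj_on h {w. (w, i) \<in> A}"
    using A by (auto intro!: inj_on_subset[OF inj])
  ultimately show ?thesis by (simp add: flow_def card_image)
qed

text \<open>The arcs between indices are carried over to the vertices by the injection
  \<open>h\<close>. Degree is in-degree plus out-degree, so in-degree at least 2 and degree at most
  \<open>f v + 1\<close> force out-degree below \<open>f v\<close>.\<close>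

lemma is_AT_of_signed_count:
  fixes vs :: "'a list" and xs :: "(nat \<times> nat) list"
  assumes vs: "distinct vs"
    and xs: "distinct xs" "\<forall>(i, j)\<in>set xs. i < length vs \<and> j < length vs \<and> i \<noteq> j \<and> (j, i) \<notin> set xs"
    and nz: "signed_count xs (replicate (length vs) 0) \<noteq> 0"
    and adj: "\<forall>i<length vs. \<forall>j<length vs. adj (vs ! i) (vs ! j) \<longleftrightarrow> (i, j) \<in> set xs \<or> (j, i) \<in> set xs"
    and indeg: "\<forall>i<length vs. 2 \<le> card {j. (j, i) \<in> set xs}"
    and f: "\<And>v. v \<in> set vs \<Longrightarrow> int (deg (set vs) (induced adj (set vs)) v) \<le> f v + 1"
  shows "is_AT (set vs) (induced adj (set vs)) f"
proof -
  define n where "n = length vs"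
  define h where "h = (\<lambda>i. vs ! i)"
  define X where "X = set xs"
  define D where "D = map_prod h h ` X"
  have inj: "inj_on h {..<n}" using vs by (auto simp: inj_on_def h_def n_def nth_eq_iff_index_eq)
  have X: "X \<subseteq> {..<n} \<times> {..<n}" "finite X" using xs by (auto simp: X_def n_def)
  have S: "set vs = h ` {..<n}" by (auto simp: h_def n_def set_conv_nth)
  have inD: "(h i, h j) \<in> D \<longleftrightarrow> (i, j) \<in> X" if "i < n" "j < n" for i j
  proof
    assume "(h i, h j) \<in> D"
    then obtain a b where ab: "(a, b) \<in> X" "h i = h a" "h j = h b" by (auto simp: D_def)
    moreover from ab(1) have "a < n" "b < n" using X by auto
    ultimately show "(i, j) \<in> X" using that inj_onD[OF inj, of i a] inj_onD[OF inj, of j b] by auto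
  qed (auto simp: D_def)
  have Dsub: "D \<subseteq> set vs \<times> set vs" using X by (auto simp: D_def S)
  have orient: "orientation (induced adj (set vs)) D"
    unfolding orientation_def
  proof (intro conjI allI impI)
    show "D \<subseteq> {(u, v). induced adj (set vs) u v}"
      using X adj by (auto simp: D_def induced_def n_def h_def X_def)
    fix u v assume "induced adj (set vs) u v"
    then obtain i j where ij: "i < n" "j < n" "u = h i" "v = h j" "adj (h i) (h j)"
      by (auto simp: induced_def S)
    then have "(i, j) \<in> X \<longleftrightarrow> (j, i) \<notin> X" using adj xs by (auto simp: X_def n_def h_def)
    then show "((u, v) \<in> D) = ((v, u) \<notin> D)" using ij by (simp add: inD)
  qed
  have nbr: "induced adj (set vs) v w \<longleftrightarrow> (v, w) \<in> D \<or> (w, v) \<in> D" if vw: "v \<in> set vs" "w \<in> set vs" for v w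
  proof -
    obtain i where "i < n" "v = h i" using vw(1) by (auto simp: S)
    moreover obtain j where "j < n" "w = h j" using vw(2) by (auto simp: S)
    moreover from calculation have "adj v w \<longleftrightarrow> (i, j) \<in> X \<or> (j, i) \<in> X" using adj by (auto simp: h_def n_def X_def)
    ultimately show ?thesis using vw by (simp add: induced_def inD)
  qed
  have out: "int (outdeg D v) < f v" if v: "v \<in> set vs" for v
  proof -
    obtain i where i: "i < n" "v = h i" using v by (auto simp: S)
    have "{u \<in> set vs. induced adj (set vs) v u} = {w. (v, w) \<in> D} \<union> {w. (w, v) \<in> D}"
      using nbr[OF v] Dsub by blast
    moreover have "{w. (v, w) \<in> D} \<inter> {w. (w, v) \<in> D} = {}"
      using orient by (auto simp: orientation_def)
    moreover have "finite D" using X by (simp add: D_def)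
    ultimately have "deg (set vs) (induced adj (set vs)) v = outdeg D v + card {w. (w, v) \<in> D}"
      by (simp add: deg_def outdeg_def card_Un_disjoint finite_out finite_in)
    moreover have "{w. (w, v) \<in> D} = h ` {j. (j, i) \<in> X}"
    proof (intro set_eqI iffI)
      fix w assume w: "w \<in> {w. (w, v) \<in> D}"
      then have "w \<in> set vs" using Dsub by auto
      then obtain j where "j < n" "w = h j" by (auto simp: S)
      then show "w \<in> h ` {j. (j, i) \<in> X}" using w i inD[of j i] by auto
    next
      fix w assume "w \<in> h ` {j. (j, i) \<in> X}"
      then obtain j where "(j, i) \<in> X" "w = h j" by auto
      then show "w \<in> {w. (w, v) \<in> D}" using i by (auto simp: D_def)
    qed
    then have "card {w. (w, v) \<in> D} = card {j. (j, i) \<in> X}"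
      using X by (auto intro!: card_image inj_on_subset[OF inj])
    ultimately show ?thesis using indeg i f[OF v] by (force simp: X_def n_def)
  qed
  have flow0: "flow (map_prod h h ` A) = (\<lambda>_. 0) \<longleftrightarrow> flow A = (\<lambda>_. 0)" if A: "A \<subseteq> X" for A
  proof -
    have AN: "A \<subseteq> {..<n} \<times> {..<n}" using A X by blast
    have out0: "flow A i = 0" if "\<not> i < n" for i
    proof -
      have "{w. (i, w) \<in> A} = {}" "{w. (w, i) \<in> A} = {}" using AN that by auto
      then show ?thesis by (simp add: flow_def)
    qed
    have out1: "flow (map_prod h h ` A) v = 0" if "v \<notin> h ` {..<n}" for v
    proof -
      have "{w. (v, w) \<in> map_prod h h ` A} = {}" "{w. (w, v) \<in> map_prod h h ` A} = {}" using AN that by auto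
      then show ?thesis by (simp add: flow_def)
    qed
    show ?thesis
    proof
      assume "flow (map_prod h h ` A) = (\<lambda>_. 0)"
      then have "flow A i = 0" for i
        using flow_image[OF inj AN, of i] out0[of i] by (cases "i < n") auto
      then show "flow A = (\<lambda>_. 0)" by blast
    next
      assume "flow A = (\<lambda>_. 0)"
      then have "flow (map_prod h h ` A) v = 0" for v
        using flow_image[OF inj AN] out1[of v] by (cases "v \<in> h ` {..<n}") auto
      then show "flow (map_prod h h ` A) = (\<lambda>_. 0)" by blast
    qed
  qed
  have inj2: "inj_on (map_prod h h) X"
    using map_prod_inj_on[OF inj inj] X(1) inj_on_subset by blast
  have card_img: "card (map_prod h h ` A) = card A" if "A \<subseteq> X" for A
    using that inj2 by (intro card_image) (auto intro: inj_on_subset)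
  \<comment> \<open>\<open>P\<close> will be \<open>even\<close> and \<open>odd\<close>; relabelling
    vertices preserves both balance and number of arcs.\<close>
  have euler: "{A. eulerian_sub D A \<and> P (card A)} = (`) (map_prod h h) ` {A \<in> Pow X. flow A = (\<lambda>_. 0) \<and> P (card A)}"
    for P
  proof (intro set_eqI iffI)
    fix B assume "B \<in> {A. eulerian_sub D A \<and> P (card A)}"
    then have B: "B \<subseteq> map_prod h h ` X" "flow B = (\<lambda>_. 0)" "P (card B)"
      by (auto simp: eulerian_sub_iff_flow D_def)
    from B(1) obtain A where A: "A \<subseteq> X" "B = map_prod h h ` A" by (auto simp: subset_image_iff)
    show "B \<in> (`) (map_prod h h) ` {A \<in> Pow X. flow A = (\<lambda>_. 0) \<and> P (card A)}"
      by (rule image_eqI[of _ _ A]) (use A B flow0[OF A(1)] card_img[OF A(1)] in auto)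
  next
    fix B assume "B \<in> (`) (map_prod h h) ` {A \<in> Pow X. flow A = (\<lambda>_. 0) \<and> P (card A)}"
    then obtain A where A: "A \<subseteq> X" "B = map_prod h h ` A" "flow A = (\<lambda>_. 0)" "P (card A)" by auto
    then show "B \<in> {A. eulerian_sub D A \<and> P (card A)}"
      using flow0[OF A(1)] card_img[OF A(1)] by (auto simp: eulerian_sub_iff_flow D_def)
  qed
  have "inj_on ((`) (map_prod h h)) (Pow X)"
    by (rule inj_on_image_Pow[OF inj2])
  then have cardE: "card {A. eulerian_sub D A \<and> P (card A)} = card {A \<in> Pow X. flow A = (\<lambda>_. 0) \<and> P (card A)}" for P
    unfolding euler by (intro card_image) (auto elim: inj_on_subset)
  have bal: "(\<lambda>i. if i < length (replicate (length vs) (0::int)) then replicate (length vs) 0 ! i else 0) = (\<lambda>_. 0)"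
    by auto
  have "signed_count xs (replicate (length vs) 0) =
      flow_sum (set xs) (\<lambda>i. if i < length (replicate (length vs) (0::int)) then replicate (length vs) 0 ! i else 0)"
    by (rule signed_count_eq_flow_sum) (use xs in auto)
  then have "signed_count xs (replicate (length vs) 0) = flow_sum X (\<lambda>_. 0)"
    by (simp only: bal X_def)
  then have nz': "flow_sum X (\<lambda>_. 0) \<noteq> 0"
    using nz by simp
  have "flow_sum X (\<lambda>_. 0) =
      int (card {A \<in> Pow X. flow A = (\<lambda>_. 0) \<and> even (card A)}) - int (card {A \<in> Pow X. flow A = (\<lambda>_. 0) \<and> odd (card A)})"
  proof -
    have "flow_sum X (\<lambda>_. 0) = (\<Sum>A\<in>Pow X. (if flow A = (\<lambda>_. 0) \<and> even (card A) then 1 else 0) -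
        (if flow A = (\<lambda>_. 0) \<and> odd (card A) then 1 else 0))"
      unfolding flow_sum_def by (rule sum.cong) auto
    then show ?thesis using X(2) by (simp add: sum_subtractf sum.If_cases Int_def conj_commute)
  qed
  with nz' have "card {A. eulerian_sub D A \<and> even (card A)} \<noteq> card {A. eulerian_sub D A \<and> odd (card A)}"
    using cardE[of even] cardE[of odd] by simp
  then show ?thesis unfolding is_AT_def using orient out by blast
qed

section \<open>Orientations verified by evaluation\<close>

lemma card_in_neighbours:
  assumes "distinct xs"
  shows "card {j. (j, i) \<in> set xs} = length (filter (\<lambda>p. snd p = i) xs)"
proof -
  have im: "{j. (j, i) \<in> set xs} = fst ` {p \<in> set xs. snd p = i}" by force
  have "card {j. (j, i) \<in> set xs} = card {p \<in> set xs. snd p = i}"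
    unfolding im by (rule card_image) (simp add: inj_on_def prod_eq_iff)
  also have "{p \<in> set xs. snd p = i} = set (filter (\<lambda>p. snd p = i) xs)" by simp
  also have "card \<dots> = length (filter (\<lambda>p. snd p = i) xs)"
    by (rule distinct_card) (use assms in simp)
  finally show ?thesis .
qed

text \<open>The conditions on the arc list are executable, and adjacency is compared only for
  indices \<open>i < j\<close>; symmetry and irreflexivity supply the other pairs.\<close>

lemma is_AT_of_arc_list:
  assumes vs: "distinct vs"
    and xs: "distinct xs \<and> list_all (\<lambda>(i, j). i < length vs \<and> j < length vs \<and> i \<noteq> j \<and> (j, i) \<notin> set xs) xs"
    and nz: "signed_count xs (replicate (length vs) 0) \<noteq> 0"
    and indeg: "list_all (\<lambda>i. 2 \<le> length (filter (\<lambda>p. snd p = i) xs)) [0..<length vs]"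
    and sym: "\<And>u v. adj u v \<Longrightarrow> adj v u" "\<And>u. \<not> adj u u"
    and adj: "list_all (\<lambda>j. list_all (\<lambda>i. adj (vs ! i) (vs ! j) \<longleftrightarrow> (i, j) \<in> set xs \<or> (j, i) \<in> set xs) [0..<j]) [0..<length vs]"
    and f: "\<And>v. v \<in> set vs \<Longrightarrow> int (deg (set vs) (induced adj (set vs)) v) \<le> f v + 1"
  shows "is_AT (set vs) (induced adj (set vs)) f"
proof (rule is_AT_of_signed_count[OF vs _ _ nz])
  show "distinct xs" using xs by simp
  show "\<forall>(i, j)\<in>set xs. i < length vs \<and> j < length vs \<and> i \<noteq> j \<and> (j, i) \<notin> set xs"
    using xs by (simp add: list_all_iff)
  show "\<forall>i<length vs. 2 \<le> card {j. (j, i) \<in> set xs}"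
    using indeg xs by (simp add: card_in_neighbours list_all_iff)
  show "\<forall>i<length vs. \<forall>j<length vs. adj (vs ! i) (vs ! j) \<longleftrightarrow> (i, j) \<in> set xs \<or> (j, i) \<in> set xs"
  proof (intro allI impI)
    fix i j assume ij: "i < length vs" "j < length vs"
    have lt: "adj (vs ! i) (vs ! j) \<longleftrightarrow> (i, j) \<in> set xs \<or> (j, i) \<in> set xs" if "i < j" "j < length vs" for i j
      using adj that by (auto simp: list_all_iff)
    consider "i < j" | "j < i" | "i = j" by linarith
    then show "adj (vs ! i) (vs ! j) \<longleftrightarrow> (i, j) \<in> set xs \<or> (j, i) \<in> set xs"
    proof cases
      case 1
      then show ?thesis using lt ij by blast
    next
      case 2
      then show ?thesis using lt[of j i] ij sym(1)[of "vs ! i" "vs ! j"] sym(1)[of "vs ! j" "vs ! i"] by blast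
    next
      case 3
      then show ?thesis using sym(2) xs by (auto simp: list_all_iff)
    qed
  qed
qed (rule f)

text \<open>The cycle is \<open>a1\<close>, \<open>a2\<close>, \<open>b1\<close>, \<open>b2\<close>
  in this order, and \<open>c1\<close>, \<open>c2\<close> are joined to it. One explicit orientation
  is evaluated.\<close>

lemma is_AT_K2_join_C4:
  assumes "distinct [c1, c2, a1, a2, b1, b2]"
    and sym: "\<And>u v. adj u v \<Longrightarrow> adj v u" "\<And>u. \<not> adj u u"
    and "adj c1 c2" "\<forall>c\<in>{c1, c2}. \<forall>u\<in>{a1, a2, b1, b2}. adj c u"
    and "adj a1 a2" "adj b1 b2" "adj a2 b1" "adj a1 b2" "\<not> adj a1 b1" "\<not> adj a2 b2"
    and f: "\<And>v. v \<in> {c1, c2, a1, a2, b1, b2} \<Longrightarrow> int (deg {c1, c2, a1, a2, b1, b2} (induced adj {c1, c2, a1, a2, b1, b2}) v) \<le> f v + 1"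
  shows "is_AT {c1, c2, a1, a2, b1, b2} (induced adj {c1, c2, a1, a2, b1, b2}) f"
proof -
  let ?vs = "[c1, c2, a1, a2, b1, b2]"
  \<comment> \<open>The numbers are positions in \<open>?vs\<close>. The arcs are grouped by the
    vertices 4, 3, 0, 1 in turn, so that each vertex soon meets no remaining arc and
    \<open>signed_count\<close> cuts off branches early.\<close>
  let ?xs = "[(4,3),(0,4),(4,1),(5,4),(3,0),(3,1),(2,3),(1,0),(0,2),(0,5),(1,2),(5,1),(2,5)] :: (nat \<times> nat) list"
  have len: "length ?vs = 6" by simp
  have "is_AT (set ?vs) (induced adj (set ?vs)) f"
  proof (rule is_AT_of_arc_list[where xs = ?xs and vs = ?vs], unfold len)
    show "signed_count ?xs (replicate 6 0) \<noteq> 0" by code_simp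
    show "distinct ?xs \<and> list_all (\<lambda>(i, j). i < 6 \<and> j < 6 \<and> i \<noteq> j \<and> (j, i) \<notin> set ?xs) ?xs" by code_simp
    show "list_all (\<lambda>i. 2 \<le> length (filter (\<lambda>p. snd p = i) ?xs)) [0..<6]" by code_simp
    have "[0..<6] = [0, 1, 2, 3, 4, 5 :: nat]" by code_simp
    then show "list_all (\<lambda>j. list_all (\<lambda>i. adj (?vs ! i) (?vs ! j) \<longleftrightarrow> (i, j) \<in> set ?xs \<or> (j, i) \<in> set ?xs) [0..<j]) [0..<6]"
      using assms by (simp add: upt_rec)
  qed (use assms in auto)
  then show ?thesis by simp
qed

text \<open>The path is \<open>a1\<close>, \<open>a2\<close>, \<open>b1\<close>, \<open>b2\<close>
  in this order, and the triangle of \<open>c1\<close>, \<open>c2\<close>, \<open>c3\<close> is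
  joined to it.\<close>

lemma is_AT_K3_join_P4:
  assumes "distinct [c1, c2, c3, a1, a2, b1, b2]"
    and sym: "\<And>u v. adj u v \<Longrightarrow> adj v u" "\<And>u. \<not> adj u u"
    and "adj c1 c2" "adj c1 c3" "adj c2 c3" "\<forall>c\<in>{c1, c2, c3}. \<forall>u\<in>{a1, a2, b1, b2}. adj c u"
    and "adj a1 a2" "adj b1 b2" "adj a2 b1" "\<not> adj a1 b2" "\<not> adj a1 b1" "\<not> adj a2 b2"
    and f: "\<And>v. v \<in> {c1, c2, c3, a1, a2, b1, b2} \<Longrightarrow>
      int (deg {c1, c2, c3, a1, a2, b1, b2} (induced adj {c1, c2, c3, a1, a2, b1, b2}) v) \<le> f v + 1"
  shows "is_AT {c1, c2, c3, a1, a2, b1, b2} (induced adj {c1, c2, c3, a1, a2, b1, b2}) f"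
proof -
  let ?vs = "[c1, c2, c3, a1, a2, b1, b2]"
  \<comment> \<open>Here the arcs are grouped by the vertices 3, 1, 4, 2, 0.\<close>
  let ?xs = "[(1,3),(4,3),(3,2),(0,3),(4,1),(2,1),(0,1),(1,6),(5,1),(2,4),(0,4),(4,5),(2,0),(6,2),(5,2),(0,6),(5,0),(6,5)] :: (nat \<times> nat) list"
  have len: "length ?vs = 7" by simp
  have "is_AT (set ?vs) (induced adj (set ?vs)) f"
  proof (rule is_AT_of_arc_list[where xs = ?xs and vs = ?vs], unfold len)
    show "signed_count ?xs (replicate 7 0) \<noteq> 0" by code_simp
    show "distinct ?xs \<and> list_all (\<lambda>(i, j). i < 7 \<and> j < 7 \<and> i \<noteq> j \<and> (j, i) \<notin> set ?xs) ?xs" by code_simp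
    show "list_all (\<lambda>i. 2 \<le> length (filter (\<lambda>p. snd p = i) ?xs)) [0..<7]" by code_simp
    have "[0..<7] = [0, 1, 2, 3, 4, 5, 6 :: nat]" by code_simp
    then show "list_all (\<lambda>j. list_all (\<lambda>i. adj (?vs ! i) (?vs ! j) \<longleftrightarrow> (i, j) \<in> set ?xs \<or> (j, i) \<in> set ?xs) [0..<j]) [0..<7]"
      using assms by (simp add: upt_rec)
  qed (use assms in auto)
  then show ?thesis by simp
qed

section \<open>Painting\<close>

text \<open>Expanding the product of \<open>x_u - x_v\<close> over the arcs \<open>(u, v)\<close> of F, A is the set of arcs from
  which the term \<open>-x_v\<close> is chosen, and \<open>expo F A w\<close> is the resulting exponent of \<open>x_w\<close>.\<close>
definition expo :: "('a \<times> 'a) set \<Rightarrow> ('a \<times> 'a) set \<Rightarrow> 'a \<Rightarrow> nat" where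
  "expo F A w = card {v. (w, v) \<in> F - A} + card {v. (v, w) \<in> A}"

text \<open>For \<open>C w = {s w}\<close> this is the coefficient of the monomial with exponents
  \<open>s\<close> in the graph polynomial; larger sets add up the coefficients over a box of
  exponents.\<close>

definition signed_sum :: "('a \<times> 'a) set \<Rightarrow> ('a \<Rightarrow> nat set) \<Rightarrow> int" where
  "signed_sum F C = (\<Sum>A\<in>Pow F. if \<forall>w. expo F A w \<in> C w then (-1) ^ card A else 0)"

section \<open>Coefficients of the graph polynomial\<close>

lemma signed_sum_split:
  assumes "C w = X \<union> Y" "X \<inter> Y = {}"
  shows "signed_sum F C = signed_sum F (C(w := X)) + signed_sum F (C(w := Y))"
proof -
  have *: "(\<forall>v. g v \<in> C v) \<longleftrightarrow> (\<forall>v. v \<noteq> w \<longrightarrow> g v \<in> C v) \<and> (g w \<in> X \<or> g w \<in> Y)"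
       "(\<forall>v. g v \<in> (C(w := Z)) v) \<longleftrightarrow> (\<forall>v. v \<noteq> w \<longrightarrow> g v \<in> C v) \<and> g w \<in> Z" for g :: "'a \<Rightarrow> nat" and Z
    using assms(1) by (metis UnE UnI1 UnI2) auto
  show ?thesis
    unfolding signed_sum_def sum.distrib[symmetric] * using assms(2) by (intro sum.cong) auto
qed

text \<open>The graph polynomial is homogeneous: each arc raises the exponent of exactly one of its
  ends by one.\<close>

lemma sum_expo:
  assumes "finite F" "A \<subseteq> F" "finite W" "F \<subseteq> W \<times> W"
  shows "(\<Sum>w\<in>W. expo F A w) = card F"
proof -
  have fin: "finite A" "finite (F - A)" using assms finite_subset by auto
  have "(\<Sum>w\<in>W. card {v. (w, v) \<in> F - A}) = card (SIGMA w:W. {v. (w, v) \<in> F - A})"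
    using finite_out[OF fin(2)] assms(3) by (subst card_SigmaI) (simp_all del: Diff_iff)
  also have "(SIGMA w:W. {v. (w, v) \<in> F - A}) = F - A" using assms by auto
  finally have 1: "(\<Sum>w\<in>W. card {v. (w, v) \<in> F - A}) = card (F - A)" .
  have "(\<Sum>w\<in>W. card {v. (v, w) \<in> A}) = card (SIGMA w:W. {v. (v, w) \<in> A})"
    using finite_in[OF fin(1)] assms(3) by (subst card_SigmaI) simp_all
  also have "\<dots> = card (prod.swap ` A)"
    by (rule arg_cong[where f=card]) (use assms in \<open>force simp: image_iff\<close>)
  also have "\<dots> = card A" by (rule card_image) auto
  finally show ?thesis
    using 1 assms fin card_mono[of F A] by (simp add: expo_def sum.distrib card_Diff_subset)
qed

text \<open>The exponents of any monomial add up to the number of arcs, so that lower bounds that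
  already add up to it must be attained.\<close>
lemma signed_sum_atLeast:
  assumes "finite F" "F \<subseteq> W \<times> W" "finite W" "M \<subseteq> W"
    and nz: "signed_sum F (\<lambda>w. {s w}) \<noteq> 0"
  shows "signed_sum F (\<lambda>w. if w \<in> M then {s w..} else {s w}) = signed_sum F (\<lambda>w. {s w})"
proof -
  have "\<exists>A\<in>Pow F. \<forall>w. expo F A w \<in> {s w}"
    using nz unfolding signed_sum_def by (rule contrapos_np) (auto intro!: sum.neutral)
  then obtain A0 where "A0 \<subseteq> F" "\<forall>w. expo F A0 w = s w" by auto
  then have s: "sum s W = card F" using sum_expo[of F A0 W] assms by simp
  have "(\<forall>w. expo F A w \<in> (if w \<in> M then {s w..} else {s w})) \<longleftrightarrow> (\<forall>w. expo F A w \<in> {s w})"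
    if A: "A \<subseteq> F" for A
  proof
    assume *: "\<forall>w. expo F A w \<in> (if w \<in> M then {s w..} else {s w})"
    have ge: "s w \<le> expo F A w" for w using *[rule_format, of w] by (auto split: if_splits)
    have "\<not> s w < expo F A w" for w
    proof
      assume "s w < expo F A w"
      moreover from this have "w \<in> W" using *[rule_format, of w] assms(4) by (auto split: if_splits)
      ultimately have "sum s W < (\<Sum>w\<in>W. expo F A w)"
        using ge assms(3) by (intro sum_strict_mono_ex1) auto
      then show False using sum_expo[of F A W] A assms s by simp
    qed
    then show "\<forall>w. expo F A w \<in> {s w}" using ge by (metis le_neq_implies_less singletonI)
  qed auto
  then show ?thesis unfolding signed_sum_def by (intro sum.cong) auto
qed

text \<open>The vertices of \<open>J\<close> are treated one at a time. All exponents split into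
  those below \<open>s x\<close> and those from \<open>s x\<close> on; if the second part
  contributes a nonzero sum, then the first part or the whole does too. The set \<open>I\<close>
  will be coloured, and the rest of \<open>J\<close> ends with strictly smaller exponents.\<close>

lemma signed_sum_free_or_less:
  assumes "finite J" "J \<subseteq> M"
    and "signed_sum F (\<lambda>w. if w \<in> M then {s w..} else {s w}) \<noteq> 0"
  shows "\<exists>I\<subseteq>J. signed_sum F (\<lambda>w. if w \<in> I then UNIV else if w \<in> J then {..<s w}
            else if w \<in> M then {s w..} else {s w}) \<noteq> 0"
  using assms(1,2)
proof (induction J rule: finite_induct)
  case empty
  then show ?case using assms(3) by simp
next
  case (insert x J)
  let ?C = "\<lambda>I J w. if w \<in> I then UNIV else if w \<in> J then {..<s w} else if w \<in> M then {s w..} else {s w}"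
  obtain I where I: "I \<subseteq> J" "signed_sum F (?C I J) \<noteq> 0" using insert by auto
  have "signed_sum F (?C (insert x I) (insert x J)) =
     signed_sum F ((?C (insert x I) (insert x J))(x := {..<s x})) +
     signed_sum F ((?C (insert x I) (insert x J))(x := {s x..}))"
    by (rule signed_sum_split) auto
  moreover have "(?C (insert x I) (insert x J))(x := {..<s x}) = ?C I (insert x J)"
    using insert I by (auto simp: fun_eq_iff)
  moreover have "(?C (insert x I) (insert x J))(x := {s x..}) = ?C I J"
    using insert I by (auto simp: fun_eq_iff)
  ultimately have "signed_sum F (?C (insert x I) (insert x J)) \<noteq> 0 \<or> signed_sum F (?C I (insert x J)) \<noteq> 0"
    using I(2) by force
  then show ?case
  proof
    assume "signed_sum F (?C (insert x I) (insert x J)) \<noteq> 0"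
    then show ?case using I(1) by (intro exI[of _ "insert x I"]) auto
  next
    assume "signed_sum F (?C I (insert x J)) \<noteq> 0"
    then show ?case using I(1) by (intro exI[of _ I]) auto
  qed
qed

text \<open>Reversing an arc between two unconstrained vertices changes the sign and nothing else.\<close>
lemma signed_sum_free_arc:
  assumes "finite F" "(u, v) \<in> F" "u \<noteq> v" "C u = UNIV" "C v = UNIV"
  shows "signed_sum F C = 0"
proof -
  define G where "G = F - {(u, v)}"
  have F: "F = insert (u, v) G" "(u, v) \<notin> G" "finite G" using assms by (auto simp: G_def)
  have "expo F (insert (u, v) A) w = expo F A w" if "w \<noteq> u" "w \<noteq> v" for A w
  proof -
    have "{x. (w, x) \<in> F - insert (u, v) A} = {x. (w, x) \<in> F - A}"
      "{x. (x, w) \<in> insert (u, v) A} = {x. (x, w) \<in> A}" using that by auto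
    then show ?thesis by (simp add: expo_def)
  qed
  then have *: "(\<forall>w. expo F (insert (u, v) A) w \<in> C w) \<longleftrightarrow> (\<forall>w. expo F A w \<in> C w)" for A
    using assms(4,5) by (metis UNIV_I)
  have "signed_sum F C = (\<Sum>A\<in>Pow G. (if \<forall>w. expo F A w \<in> C w then (-1) ^ card A else 0) +
      (if \<forall>w. expo F (insert (u, v) A) w \<in> C w then (-1) ^ card (insert (u, v) A) else 0))"
    unfolding signed_sum_def by (subst F(1), rule sum_Pow_insert) (use F in auto)
  also have "\<dots> = 0"
  proof (rule sum.neutral, intro ballI)
    fix A assume "A \<in> Pow G"
    then have "finite A" "(u, v) \<notin> A" using F finite_subset by auto
    then show "(if \<forall>w. expo F A w \<in> C w then (-1) ^ card A else 0) +
      (if \<forall>w. expo F (insert (u, v) A) w \<in> C w then (-1) ^ card (insert (u, v) A) else 0) = (0 :: int)"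
      unfolding * by simp
  qed
  finally show ?thesis .
qed

text \<open>Grouping the arc subsets by their exponents writes the sum as a sum of single
  coefficients from the box.\<close>

lemma signed_sum_nonzero_point:
  assumes "finite F" "signed_sum F C \<noteq> 0"
  shows "\<exists>s. (\<forall>w. s w \<in> C w) \<and> signed_sum F (\<lambda>w. {s w}) \<noteq> 0"
proof (rule ccontr)
  assume no: "\<not> ?thesis"
  have "signed_sum F C = (\<Sum>e\<in>expo F ` Pow F. \<Sum>A\<in>{A \<in> Pow F. expo F A = e}.
      if \<forall>w. expo F A w \<in> C w then (-1) ^ card A else 0)"
    unfolding signed_sum_def by (rule sum.image_gen) (use assms in auto)
  also have "\<dots> = 0"
  proof (rule sum.neutral, intro ballI)
    fix e
    have "(\<Sum>A\<in>{A \<in> Pow F. expo F A = e}. if \<forall>w. expo F A w \<in> C w then (-1) ^ card A else 0) =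
        (\<Sum>A\<in>{A \<in> Pow F. expo F A = e}. if \<forall>w. e w \<in> C w then (-1) ^ card A else 0)"
      by (rule sum.cong) auto
    also have "\<dots> = (if \<forall>w. e w \<in> C w then signed_sum F (\<lambda>w. {e w}) else 0)"
      unfolding signed_sum_def
      by (subst sum.inter_filter) (use assms(1) in \<open>auto simp: fun_eq_iff intro!: sum.cong sum.neutral\<close>)
    finally show "(\<Sum>A\<in>{A \<in> Pow F. expo F A = e}. if \<forall>w. expo F A w \<in> C w then (-1) ^ card A else (0::int)) = 0"
      using no by auto
  qed
  finally show False using assms by simp
qed

text \<open>The polynomial is the product of those of \<open>F1\<close> and \<open>F2\<close>. For a
  fixed choice \<open>A2\<close> on \<open>F2\<close>, the exponents on \<open>F1\<close> are
  shifted by \<open>c = expo F2 A2\<close>, and some \<open>A2\<close> must give a nonzero inner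
  sum.\<close>

lemma signed_sum_restrict:
  assumes "finite F" "F = F1 \<union> F2" "F1 \<inter> F2 = {}" "signed_sum F C \<noteq> 0"
  shows "\<exists>c. signed_sum F1 (\<lambda>w. {n. n + c w \<in> C w}) \<noteq> 0"
proof (rule ccontr)
  assume no: "\<not> ?thesis"
  have fin: "finite F1" "finite F2" using assms by auto
  have ex: "expo F (A1 \<union> A2) w = expo F1 A1 w + expo F2 A2 w" if A: "A1 \<subseteq> F1" "A2 \<subseteq> F2" for A1 A2 w
  proof -
    have "finite A1" "finite A2" "finite (F1 - A1)" "finite (F2 - A2)" using A fin finite_subset by auto
    note fin' = this[THEN finite_out] this[THEN finite_in]
    have "{v. (w, v) \<in> F - (A1 \<union> A2)} = {v. (w, v) \<in> F1 - A1} \<union> {v. (w, v) \<in> F2 - A2}"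
      "{v. (v, w) \<in> A1 \<union> A2} = {v. (v, w) \<in> A1} \<union> {v. (v, w) \<in> A2}"
      "{v. (w, v) \<in> F1 - A1} \<inter> {v. (w, v) \<in> F2 - A2} = {}"
      "{v. (v, w) \<in> A1} \<inter> {v. (v, w) \<in> A2} = {}"
      using A assms(2,3) by auto
    then show ?thesis unfolding expo_def using fin' by (simp add: card_Un_disjoint)
  qed
  let ?f = "\<lambda>A. if \<forall>w. expo F A w \<in> C w then (-1) ^ card A else (0 :: int)"
  have "bij_betw (\<lambda>(A2, A1). A1 \<union> A2) (Pow F2 \<times> Pow F1) (Pow F)"
    by (rule bij_betw_byWitness[of _ "\<lambda>A. (A \<inter> F2, A \<inter> F1)"]) (use assms(2,3) in auto)
  then have "signed_sum F C = (\<Sum>p\<in>Pow F2 \<times> Pow F1. ?f ((\<lambda>(A2, A1). A1 \<union> A2) p))"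
    unfolding signed_sum_def by (rule sum.reindex_bij_betw[symmetric])
  also have "\<dots> = (\<Sum>A2\<in>Pow F2. \<Sum>A1\<in>Pow F1. ?f (A1 \<union> A2))"
    unfolding sum.cartesian_product by (intro sum.cong) auto
  also have "\<dots> = (\<Sum>A2\<in>Pow F2. (-1) ^ card A2 * signed_sum F1 (\<lambda>w. {n. n + expo F2 A2 w \<in> C w}))"
  proof (rule sum.cong[OF refl])
    fix A2 assume A2: "A2 \<in> Pow F2"
    have "card (A1 \<union> A2) = card A1 + card A2" if "A1 \<subseteq> F1" for A1
      using A2 that assms(3) fin by (intro card_Un_disjoint) (auto intro: finite_subset)
    then show "(\<Sum>A1\<in>Pow F1. ?f (A1 \<union> A2)) =
        (-1) ^ card A2 * signed_sum F1 (\<lambda>w. {n. n + expo F2 A2 w \<in> C w})"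
      unfolding signed_sum_def sum_distrib_left using A2 ex
      by (intro sum.cong) (auto simp: power_add)
  qed
  also have "\<dots> = 0" using no by (intro sum.neutral) auto
  finally show False using assms by simp
qed

text \<open>\<open>t w\<close> is the number of times that \<open>w\<close> may still be marked
  without being coloured, so that \<open>t w + 1\<close> tokens suffice. The condition
  \<open>1 \<le> t w\<close> ensures that \<open>t w - 1\<close> is a true decrease.\<close>

definition maintainable :: "('a \<Rightarrow> 'a \<Rightarrow> bool) \<Rightarrow> ('a set \<Rightarrow> ('a \<Rightarrow> nat) \<Rightarrow> bool) \<Rightarrow> bool" where
  "maintainable adj Q \<longleftrightarrow> (\<forall>U t M. Q U t \<and> M \<subseteq> U \<longrightarrow>
     (\<exists>I\<subseteq>M. independent adj I \<and> (\<forall>w\<in>M - I. 1 \<le> t w) \<and>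
        Q (U - I) (\<lambda>w. if w \<in> M then t w - 1 else t w)))"

section \<open>Painter's strategies\<close>

lemma painter_win_cong:
  assumes "painter_win adj U g" "\<And>u. u \<in> U \<Longrightarrow> g u = h u"
  shows "painter_win adj U h"
  using assms
proof (induction arbitrary: h rule: painter_win.induct)
  case (pw_done U g)
  then show ?case by (auto intro: painter_win.pw_done)
next
  case (pw_step U g)
  show ?case
  proof (rule painter_win.pw_step[OF pw_step(1)], intro allI impI)
    fix M assume M: "M \<noteq> {} \<and> M \<subseteq> U"
    then obtain I where I: "I \<subseteq> M" "independent adj I"
      "\<forall>u\<in>U - I. (if u \<in> M then g u - 1 else g u) > 0"
      "\<And>h. (\<And>u. u \<in> U - I \<Longrightarrow> (if u \<in> M then g u - 1 else g u) = h u) \<Longrightarrow> painter_win adj (U - I) h"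
      using pw_step(2)[rule_format, OF M] by (elim exE conjE) (rule that, assumption+, simp)
    then show "\<exists>I. I \<subseteq> M \<and> independent adj I \<and> (\<forall>u\<in>U - I. (if u \<in> M then h u - 1 else h u) > 0) \<and>
       painter_win adj (U - I) (\<lambda>u. if u \<in> M then h u - 1 else h u)"
    proof (intro exI conjI)
      have eq: "(if u \<in> M then g u - 1 else g u) = (if u \<in> M then h u - 1 else h u)" if "u \<in> U - I" for u
        using pw_step(3)[of u] that by simp
      show "\<forall>u\<in>U - I. (if u \<in> M then h u - 1 else h u) > 0"
        using I(3) eq by metis
      show "painter_win adj (U - I) (\<lambda>u. if u \<in> M then h u - 1 else h u)"
        by (rule I(4)) (rule eq)
    qed (rule I(1), rule I(2))
  qed
qed

lemma painter_win_response:
  assumes "painter_win adj U g" "M \<subseteq> U" "M \<noteq> {}"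
  obtains I where "I \<subseteq> M" "independent adj I" "\<forall>u\<in>U - I. (if u \<in> M then g u - 1 else g u) > 0"
    "painter_win adj (U - I) (\<lambda>u. if u \<in> M then g u - 1 else g u)"
  using assms(1)
proof cases
  case pw_done
  then show ?thesis using assms by auto
next
  case pw_step
  then obtain I where "I \<subseteq> M" "independent adj I" "\<forall>u\<in>U - I. (if u \<in> M then g u - 1 else g u) > 0"
    "painter_win adj (U - I) (\<lambda>u. if u \<in> M then g u - 1 else g u)"
    using assms(2,3) by (elim allE[of _ M] impE exE conjE) auto
  then show ?thesis by (rule that)
qed

text \<open>Painter answers inside A first; the vertices of T with a neighbour coloured in this answer
  lose a token, but also a neighbour in A, and she plays the maintainable relation on the rest of T.\<close>
lemma painter_win_union:
  assumes Q: "maintainable adj Q" and sym: "\<And>u v. adj u v \<Longrightarrow> adj v u"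
    and "painter_win adj A g" "Q T t" "finite A" "finite T" "A \<inter> T = {}"
    and "\<forall>v\<in>A. 0 < g v" "\<forall>v\<in>T. t v + card {u \<in> A. adj v u} < g v"
  shows "painter_win adj (A \<union> T) g"
  using assms(3-)
\<comment> \<open>The total number of tokens on uncoloured vertices drops in every round: a marked
  vertex either disappears with its positive supply or loses a token.\<close>
proof (induction "\<Sum>v\<in>A \<union> T. g v" arbitrary: A T g t rule: less_induct)
  case less
  note win = less.prems(1) and QT = less.prems(2) and fin = less.prems(3,4) and disj = less.prems(5)
    and posA = less.prems(6) and tok = less.prems(7)
  show ?case
  proof (cases "A \<union> T = {}")
    case True
    then show ?thesis by (rule painter_win.pw_done)
  next
    case False
    show ?thesis
    proof (rule painter_win.pw_step[OF False], intro allI impI)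
      fix M assume M: "M \<noteq> {} \<and> M \<subseteq> A \<union> T"
      let ?g = "\<lambda>u. if u \<in> M then g u - 1 else g u"
      obtain I1 where I1: "I1 \<subseteq> M \<inter> A" "independent adj I1" "\<forall>u\<in>A - I1. ?g u > 0" "painter_win adj (A - I1) ?g"
      proof (cases "M \<inter> A = {}")
        \<comment> \<open>A winning position answers only nonempty sets; here nothing in
          \<open>A\<close> is marked and the position on \<open>A\<close> stays as it is.\<close>
        case True
        have "painter_win adj A ?g" by (rule painter_win_cong[OF win]) (use True in auto)
        then show ?thesis using posA True by (intro that[of "{}"]) (auto simp: independent_def)
      next
        case False
        then obtain I where I: "I \<subseteq> M \<inter> A" "independent adj I"
          "\<forall>u\<in>A - I. (if u \<in> M \<inter> A then g u - 1 else g u) > 0"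
          "painter_win adj (A - I) (\<lambda>u. if u \<in> M \<inter> A then g u - 1 else g u)"
          using painter_win_response[OF win, of "M \<inter> A"] by blast
        have "painter_win adj (A - I) ?g" by (rule painter_win_cong[OF I(4)]) auto
        then show ?thesis using I by (intro that[of I]) auto
      qed
      define M2 where "M2 = {v \<in> M \<inter> T. \<not> (\<exists>u\<in>I1. adj v u)}"
      obtain I2 where I2: "I2 \<subseteq> M2" "independent adj I2" "\<forall>w\<in>M2 - I2. 1 \<le> t w"
         "Q (T - I2) (\<lambda>w. if w \<in> M2 then t w - 1 else t w)"
        using Q[unfolded maintainable_def, rule_format, of T t M2] QT by (auto simp: M2_def)
      let ?t = "\<lambda>w. if w \<in> M2 then t w - 1 else t w"
      have ind: "independent adj (I1 \<union> I2)"
        using I1(2) I2(1,2) sym unfolding independent_def M2_def by blast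
      have tok': "\<forall>v\<in>T - I2. ?t v + card {u \<in> A - I1. adj v u} < ?g v"
      proof
        fix v assume v: "v \<in> T - I2"
        have le: "card {u \<in> A - I1. adj v u} \<le> card {u \<in> A. adj v u}"
          using fin by (intro card_mono) auto
        have old: "t v + card {u \<in> A. adj v u} < g v" using tok v by blast
        consider "v \<notin> M" | "v \<in> M2" | "v \<in> M" "v \<notin> M2" by blast
        then show "?t v + card {u \<in> A - I1. adj v u} < ?g v"
        proof cases
          case 1
          then have "v \<notin> M2" by (simp add: M2_def)
          then show ?thesis using le old 1 by simp
        next
          case 2
          then have "v \<in> M" "1 \<le> t v" using I2(3) v by (auto simp: M2_def)
          then show ?thesis using le old 2 by simp
        next
          case 3
          then obtain u where "u \<in> I1" "adj v u" using v by (auto simp: M2_def)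
          then have "{u \<in> A - I1. adj v u} \<subset> {u \<in> A. adj v u}" using I1(1) by auto
          then have "card {u \<in> A - I1. adj v u} < card {u \<in> A. adj v u}"
            using fin by (intro psubset_card_mono) auto
          then show ?thesis using old 3 by simp
        qed
      qed
      have sub: "I1 \<union> I2 \<subseteq> M" using I1(1) I2(1) by (auto simp: M2_def)
      have split: "(A \<union> T) - (I1 \<union> I2) = (A - I1) \<union> (T - I2)"
        using I1(1) I2(1) disj by (auto simp: M2_def)
      have pos: "\<forall>u\<in>(A \<union> T) - (I1 \<union> I2). ?g u > 0"
        unfolding split
      proof
        fix u assume "u \<in> (A - I1) \<union> (T - I2)"
        then consider "u \<in> A - I1" | "u \<in> T - I2" by blast
        then show "?g u > 0"
        proof cases
          case 1
          then show ?thesis using I1(3) by blast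
        next
          case 2
          then show ?thesis using bspec[OF tok' 2] by linarith
        qed
      qed
      have posU: "0 < g v" if "v \<in> A \<union> T" for v using that posA bspec[OF tok, of v] by (cases "v \<in> A") auto
      obtain m where m: "m \<in> M" using M by blast
      have "(\<Sum>v\<in>(A - I1) \<union> (T - I2). ?g v) < (\<Sum>v\<in>A \<union> T. g v)"
      proof (cases "m \<in> I1 \<union> I2")
        case True
        have "(\<Sum>v\<in>(A - I1) \<union> (T - I2). ?g v) \<le> (\<Sum>v\<in>(A - I1) \<union> (T - I2). g v)"
          by (rule sum_mono) auto
        also have "\<dots> < (\<Sum>v\<in>A \<union> T. g v)"
        proof (rule sum_strict_mono2[of _ _ m])
          show "m \<in> A \<union> T - ((A - I1) \<union> (T - I2))" using True split M m by blast
          show "0 < g m" using posU m M by blast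
        qed (use fin in auto)
        finally show ?thesis .
      next
        case False
        have "(\<Sum>v\<in>(A - I1) \<union> (T - I2). ?g v) < (\<Sum>v\<in>(A - I1) \<union> (T - I2). g v)"
        proof (rule sum_strict_mono_ex1)
          have "m \<in> (A - I1) \<union> (T - I2)" using False m M by auto
          moreover have "0 < g m" using posU m M by blast
          ultimately show "\<exists>v\<in>(A - I1) \<union> (T - I2). ?g v < g v" using m by (intro bexI[of _ m]) simp_all
        qed (use fin in auto)
        also have "\<dots> \<le> (\<Sum>v\<in>A \<union> T. g v)"
          by (rule sum_mono2) (use fin in auto)
        finally show ?thesis .
      qed
      then have win': "painter_win adj ((A - I1) \<union> (T - I2)) ?g"
      proof (rule less.hyps[OF _ I1(4) I2(4) _ _ _ I1(3) tok'])
        show "finite (A - I1)" "finite (T - I2)" "(A - I1) \<inter> (T - I2) = {}" using fin disj by auto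
      qed
      show "\<exists>I. I \<subseteq> M \<and> independent adj I \<and> (\<forall>u\<in>A \<union> T - I. 0 < ?g u) \<and> painter_win adj (A \<union> T - I) ?g"
      proof (intro exI conjI)
        show "painter_win adj (A \<union> T - (I1 \<union> I2)) ?g" unfolding split by (rule win')
      qed (rule sub, rule ind, rule pos)
    qed
  qed
qed

text \<open>Raising the exponents allowed on \<open>M\<close> does not change the coefficient, and
  \<open>signed_sum_free_or_less\<close> then frees a set \<open>I\<close> and lowers the rest of
  \<open>M\<close>. Two adjacent free vertices would make the sum vanish, so \<open>I\<close> is
  independent. Dropping the arcs that meet \<open>I\<close> leaves a nonzero coefficient whose
  exponents have decreased on \<open>M - I\<close>.\<close>

lemma maintainable_signed_sum:
  assumes D: "finite D" "\<forall>(u, v)\<in>D. u \<noteq> v" "\<And>u v. u \<in> S \<Longrightarrow> v \<in> S \<Longrightarrow> adj u v \<Longrightarrow> (u, v) \<in> D \<or> (v, u) \<in> D"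
    and S: "finite S"
  shows "maintainable adj (\<lambda>U t. U \<subseteq> S \<and> (\<exists>s. signed_sum (D \<inter> U \<times> U) (\<lambda>w. {s w}) \<noteq> 0 \<and> (\<forall>w\<in>U. s w \<le> t w)))"
  unfolding maintainable_def
proof (intro allI impI, elim conjE exE)
  fix U t M s
  assume U: "U \<subseteq> S" and M: "M \<subseteq> U" and s: "signed_sum (D \<inter> U \<times> U) (\<lambda>w. {s w}) \<noteq> 0" "\<forall>w\<in>U. s w \<le> t w"
  let ?F = "D \<inter> U \<times> U"
  have finU: "finite U" "finite M" "finite ?F"
    using finite_subset[OF U S] finite_subset[OF subset_trans[OF M U] S] D(1) by auto
  have "signed_sum ?F (\<lambda>w. if w \<in> M then {s w..} else {s w}) \<noteq> 0"
    using signed_sum_atLeast[of ?F U M s] finU M s by auto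
  from signed_sum_free_or_less[OF finU(2) subset_refl this]
  obtain I where I: "I \<subseteq> M" "signed_sum ?F (\<lambda>w. if w \<in> I then UNIV else if w \<in> M then {..<s w}
            else if w \<in> M then {s w..} else {s w}) \<noteq> 0" by blast
  let ?C = "\<lambda>w. if w \<in> I then UNIV else if w \<in> M then {..<s w} else {s w}"
  have I2: "signed_sum ?F ?C \<noteq> 0" using I(2) by (simp cong: if_cong)
  have ind: "independent adj I"
    unfolding independent_def
  proof (intro ballI notI)
    fix u v assume uv: "u \<in> I" "v \<in> I" "adj u v"
    then have "(u, v) \<in> ?F \<or> (v, u) \<in> ?F" using D(3)[of u v] I(1) M U by blast
    then obtain a b where "(a, b) \<in> ?F" "a \<in> I" "b \<in> I" using uv by blast
    then show False using signed_sum_free_arc[OF finU(3), of a b ?C] D(2) I2 by auto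
  qed
  let ?F1 = "D \<inter> (U - I) \<times> (U - I)"
  have "?F = ?F1 \<union> (?F - ?F1)" "?F1 \<inter> (?F - ?F1) = {}" by auto
  from signed_sum_restrict[OF finU(3) this I2]
  obtain c where "signed_sum ?F1 (\<lambda>w. {n. n + c w \<in> ?C w}) \<noteq> 0" by blast
  \<comment> \<open>\<open>c w\<close> is the share of the dropped arcs in the exponent, hence
    \<open>s' w\<close> is at most the value allowed before.\<close>
  then obtain s' where s': "\<forall>w. s' w \<in> {n. n + c w \<in> ?C w}" "signed_sum ?F1 (\<lambda>w. {s' w}) \<noteq> 0"
    using signed_sum_nonzero_point[of ?F1] D(1) by blast
  have le: "(if w \<in> M then s' w < s w else s' w \<le> s w)" if "w \<notin> I" for w
    using s'(1)[rule_format, of w] that by (auto split: if_splits)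
  show "\<exists>I\<subseteq>M. independent adj I \<and> (\<forall>w\<in>M - I. 1 \<le> t w) \<and> U - I \<subseteq> S \<and>
      (\<exists>s. signed_sum (D \<inter> (U - I) \<times> (U - I)) (\<lambda>w. {s w}) \<noteq> 0 \<and>
        (\<forall>w\<in>U - I. s w \<le> (if w \<in> M then t w - 1 else t w)))"
  proof (intro exI[of _ I] conjI exI[of _ s'] ballI)
    fix w assume "w \<in> M - I"
    then have "s' w < s w" "s w \<le> t w" using le[of w] s(2) M by auto
    then show "1 \<le> t w" by simp
  next
    fix w assume w: "w \<in> U - I"
    then show "s' w \<le> (if w \<in> M then t w - 1 else t w)" using le[of w] s(2) by fastforce
  qed (use I ind s' U in auto)
qed

text \<open>Painter colours a kernel of the marked set. Every other marked vertex has an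
  out-neighbour in it, so its remaining out-degree drops along with its tokens.\<close>

lemma maintainable_kernel:
  assumes K: "kernel_perfect S D" and S: "finite S"
    and D: "\<And>u v. u \<in> S \<Longrightarrow> v \<in> S \<Longrightarrow> adj u v \<Longrightarrow> D u v + D v u > 0"
  shows "maintainable adj (\<lambda>U t. U \<subseteq> S \<and> (\<forall>v\<in>U. (\<Sum>w\<in>U. D v w) \<le> t v))"
  unfolding maintainable_def
proof (intro allI impI, elim conjE)
  fix U t M assume U: "U \<subseteq> S" "\<forall>v\<in>U. (\<Sum>w\<in>U. D v w) \<le> t v" and M: "M \<subseteq> U"
  then have "has_kernel D M" using K by (auto simp: kernel_perfect_def)
  then obtain I where I: "I \<subseteq> M" "\<forall>x\<in>I. \<forall>y\<in>I. D x y = 0" "\<forall>x\<in>M - I. \<exists>y\<in>I. D x y > 0"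
    by (auto simp: has_kernel_def)
  have finU: "finite U" using U S finite_subset by auto
  have *: "(\<Sum>w\<in>U - I. D v w) < (\<Sum>w\<in>U. D v w)" if v: "v \<in> M - I" for v
  proof -
    obtain y where y: "y \<in> I" "D v y > 0" using I(3) v by blast
    show ?thesis
    proof (rule sum_strict_mono2[of _ _ y])
      show "y \<in> U - (U - I)" using y I(1) M by blast
    qed (use finU y in auto)
  qed
  have le: "(\<Sum>w\<in>U - I. D v w) \<le> (\<Sum>w\<in>U. D v w)" for v
    using finU by (intro sum_mono2) auto
  have ind: "independent adj I"
    unfolding independent_def
  proof (intro ballI notI)
    fix u v assume "u \<in> I" "v \<in> I" "adj u v"
    moreover from this have "u \<in> S" "v \<in> S" using I(1) M U(1) by auto
    ultimately show False using D[of u v] I(2) by force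
  qed
  show "\<exists>I\<subseteq>M. independent adj I \<and> (\<forall>w\<in>M - I. 1 \<le> t w) \<and> U - I \<subseteq> S \<and>
     (\<forall>v\<in>U - I. (\<Sum>w\<in>U - I. D v w) \<le> (if v \<in> M then t v - 1 else t v))"
  proof (intro exI[of _ I] conjI ballI)
    fix w assume w: "w \<in> M - I"
    then have "(\<Sum>w'\<in>U. D w w') \<le> t w" using U(2) M by blast
    then show "1 \<le> t w" using *[OF w] by linarith
  next
    fix v assume v: "v \<in> U - I"
    have "(\<Sum>w\<in>U. D v w) \<le> t v" using U(2) v by blast
    then show "(\<Sum>w\<in>U - I. D v w) \<le> (if v \<in> M then t v - 1 else t v)"
    proof (cases "v \<in> M")
      case True
      then have "v \<in> M - I" using v by blast
      from *[OF this] show ?thesis using True \<open>(\<Sum>w\<in>U. D v w) \<le> t v\<close> by simp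
    next
      case False
      then show ?thesis using le[of v] \<open>(\<Sum>w\<in>U. D v w) \<le> t v\<close> by simp
    qed
  next
    show "I \<subseteq> M" by (rule I(1))
    show "independent adj I" by (rule ind)
    show "U - I \<subseteq> S" using U(1) by blast
  qed
qed

text \<open>In both cases the reserve \<open>t\<close> is the out-degree in the orientation, which
  is below \<open>f\<close>. The bound on \<open>f\<close> leaves a token for each neighbour outside
  \<open>S\<close> and one more, as \<open>painter_win_union\<close> requires.\<close>

lemma painter_win_extend:
  assumes G: "finite U" "\<And>u v. adj u v \<Longrightarrow> adj v u" "\<And>u. \<not> adj u u"
    and S: "S \<subseteq> U"
    and red: "is_AT S (induced adj S) f \<or> is_KP S (induced adj S) f"
    and f: "\<And>v. v \<in> S \<Longrightarrow> f v \<le> int k - int (card {u \<in> U - S. adj v u})"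
    and win: "painter_win adj (U - S) (\<lambda>_. k)" and k: "0 < k"
  shows "painter_win adj U (\<lambda>_. k)"
proof -
  have finS: "finite S" using G(1) S finite_subset by auto
  obtain Q t where Q: "maintainable adj Q" "Q S t" "\<forall>v\<in>S. int (t v) < f v"
    using red
  proof
    assume "is_AT S (induced adj S) f"
    then obtain D where D: "orientation (induced adj S) D" "\<forall>v\<in>S. int (outdeg D v) < f v"
      "card {A. eulerian_sub D A \<and> even (card A)} \<noteq> card {A. eulerian_sub D A \<and> odd (card A)}"
      unfolding is_AT_def by blast
    have DS: "D \<subseteq> S \<times> S" using D(1) by (auto simp: orientation_def induced_def)
    have finD: "finite D" using DS finS finite_subset by blast
    \<comment> \<open>Choosing \<open>A\<close> replaces, at each vertex, its out-arcs in
      \<open>A\<close> by its in-arcs in \<open>A\<close>. Hence the coefficient at the out-degrees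
      is the difference between even and odd Eulerian subgraphs.\<close>
    have eul: "(\<forall>w. expo D A w \<in> {outdeg D w}) \<longleftrightarrow> eulerian_sub D A" if "A \<subseteq> D" for A
    proof -
      have "finite A" using that finD finite_subset by auto
      have "expo D A w = outdeg D w \<longleftrightarrow> card {v. (w, v) \<in> A} = card {v. (v, w) \<in> A}" for w
      proof -
        have "{v. (w, v) \<in> D} = {v. (w, v) \<in> D - A} \<union> {v. (w, v) \<in> A}"
          "{v. (w, v) \<in> D - A} \<inter> {v. (w, v) \<in> A} = {}" using that by auto
        moreover have "finite {v. (w, v) \<in> D - A}" "finite {v. (w, v) \<in> A}"
          using finD \<open>finite A\<close> by (auto intro!: finite_out simp del: Diff_iff)
        ultimately have "outdeg D w = card {v. (w, v) \<in> D - A} + card {v. (w, v) \<in> A}"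
          unfolding outdeg_def by (simp add: card_Un_disjoint del: Diff_iff)
        then show ?thesis by (auto simp: expo_def)
      qed
      then show ?thesis using that by (simp add: eulerian_sub_def)
    qed
    have "signed_sum D (\<lambda>w. {outdeg D w}) = (\<Sum>A\<in>Pow D. (if eulerian_sub D A \<and> even (card A) then 1 else 0) -
        (if eulerian_sub D A \<and> odd (card A) then 1 else 0))"
      unfolding signed_sum_def by (rule sum.cong) (auto simp: eul[simplified])
    then have "signed_sum D (\<lambda>w. {outdeg D w}) = int (card {A \<in> Pow D. eulerian_sub D A \<and> even (card A)}) - int (card {A \<in> Pow D. eulerian_sub D A \<and> odd (card A)})"
      using finD by (simp add: sum_subtractf sum.If_cases Int_def)
    moreover have "{A \<in> Pow D. eulerian_sub D A \<and> even (card A)} = {A. eulerian_sub D A \<and> even (card A)}"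
      "{A \<in> Pow D. eulerian_sub D A \<and> odd (card A)} = {A. eulerian_sub D A \<and> odd (card A)}"
      by (auto simp: eulerian_sub_def)
    ultimately have nz: "signed_sum (D \<inter> S \<times> S) (\<lambda>w. {outdeg D w}) \<noteq> 0"
      using D(3) DS by (simp add: Int_absorb2)
    have ne: "\<forall>(u, v)\<in>D. u \<noteq> v" using D(1) G(3) by (auto simp: orientation_def induced_def)
    have cov: "(u, v) \<in> D \<or> (v, u) \<in> D" if "u \<in> S" "v \<in> S" "adj u v" for u v
      using D(1) that by (auto simp: orientation_def induced_def)
    show thesis
      using that[OF maintainable_signed_sum[OF finD ne cov finS], of "outdeg D"] nz D(2) by auto
  next
    assume "is_KP S (induced adj S) f"
    then obtain D :: "'a \<Rightarrow> 'a \<Rightarrow> nat" where D: "\<forall>u v. induced adj S u v \<longrightarrow> D u v + D v u > 0"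
      "kernel_perfect S D" "\<forall>v\<in>S. int (\<Sum>w\<in>S. D v w) < f v"
      unfolding is_KP_def by blast
    have cov: "D u v + D v u > 0" if "u \<in> S" "v \<in> S" "adj u v" for u v
      using D(1) that by (simp add: induced_def)
    show thesis
      using that[OF maintainable_kernel[OF D(2) finS cov], of "\<lambda>v. \<Sum>w\<in>S. D v w"] D(3) by auto
  qed
  have "painter_win adj ((U - S) \<union> S) (\<lambda>_. k)"
  proof (rule painter_win_union[OF Q(1) G(2) win Q(2)])
    show "\<forall>v\<in>S. t v + card {u \<in> U - S. adj v u} < k"
    proof
      fix v assume "v \<in> S"
      then show "t v + card {u \<in> U - S. adj v u} < k" using Q(3) f[of v] by fastforce
    qed
  qed (use G finS k in auto)
  then show ?thesis using S by (simp add: Un_absorb2)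
qed

section \<open>Hall's theorem and cuts\<close>

text \<open>If some nonempty proper \<open>J\<close> is tight, \<open>J\<close> is matched first and
  the rest avoids its neighbourhood. Otherwise every nonempty proper subset has a surplus, and one
  index can be matched arbitrarily.\<close>

theorem hall:
  fixes A :: "'i \<Rightarrow> 'a set"
  assumes "finite I" "\<And>i. i \<in> I \<Longrightarrow> finite (A i)"
    and "\<And>J. J \<subseteq> I \<Longrightarrow> card J \<le> card (\<Union>i\<in>J. A i)"
  shows "\<exists>f. inj_on f I \<and> (\<forall>i\<in>I. f i \<in> A i)"
  using assms
proof (induction I arbitrary: A rule: finite_psubset_induct)
  case (psubset I)
  note finI = psubset.hyps and finA = psubset.prems(1) and hall = psubset.prems(2)
  show ?case
  proof (cases "\<exists>J\<subset>I. J \<noteq> {} \<and> card (\<Union>i\<in>J. A i) \<le> card J")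
    case True
    then obtain J where J: "J \<subset> I" "J \<noteq> {}" "card (\<Union>i\<in>J. A i) \<le> card J" by blast
    let ?B = "\<Union>i\<in>J. A i"
    have finJ: "finite J" using J(1) finI finite_subset by blast
    have finB: "finite ?B" using finJ finA J(1) by blast
    have "\<exists>f. inj_on f J \<and> (\<forall>i\<in>J. f i \<in> A i)"
      by (rule psubset.IH[OF J(1)]) (use finA hall J(1) in auto)
    then obtain f where f: "inj_on f J" "\<forall>i\<in>J. f i \<in> A i" by blast
    have "\<exists>g. inj_on g (I - J) \<and> (\<forall>i\<in>I - J. g i \<in> A i - ?B)"
    proof (rule psubset.IH)
      show "I - J \<subset> I" using J by blast
      show "finite (A i - ?B)" if "i \<in> I - J" for i using that finA by auto
      fix K assume K: "K \<subseteq> I - J"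
      have finK: "finite K" using K finI finite_subset by blast
      have "card J + card K = card (J \<union> K)" using K finJ finK by (subst card_Un_disjoint) auto
      also have "\<dots> \<le> card (\<Union>i\<in>J \<union> K. A i)" using K J(1) by (intro hall) auto
      also have "(\<Union>i\<in>J \<union> K. A i) = ?B \<union> (\<Union>i\<in>K. A i - ?B)" by auto
      also have "card \<dots> \<le> card ?B + card (\<Union>i\<in>K. A i - ?B)" by (rule card_Un_le)
      finally show "card K \<le> card (\<Union>i\<in>K. A i - ?B)" using J(3) by linarith
    qed
    then obtain g where g: "inj_on g (I - J)" "\<forall>i\<in>I - J. g i \<in> A i - ?B" by blast
    let ?h = "\<lambda>i. if i \<in> J then f i else g i"
    have "inj_on ?h I"
    proof (rule inj_onI)
      fix i j assume ij: "i \<in> I" "j \<in> I" "?h i = ?h j"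
      have ne: "f a \<noteq> g b" if "a \<in> J" "b \<in> I - J" for a b using that f(2) g(2) by (metis DiffD2 UN_I)
      show "i = j"
        using ij ne[of i j] ne[of j i] f(1) g(1) by (cases "i \<in> J"; cases "j \<in> J") (auto dest: inj_onD)
    qed
    moreover have "\<forall>i\<in>I. ?h i \<in> A i" using f(2) g(2) by auto
    ultimately show ?thesis by blast
  next
    case False
    show ?thesis
    proof (cases "I = {}")
      case False
      then obtain i0 where i0: "i0 \<in> I" by blast
      have "card {i0} \<le> card (\<Union>i\<in>{i0}. A i)" using i0 by (intro hall) auto
      then have "A i0 \<noteq> {}" by auto
      then obtain a where a: "a \<in> A i0" by blast
      have "\<exists>g. inj_on g (I - {i0}) \<and> (\<forall>i\<in>I - {i0}. g i \<in> A i - {a})"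
      proof (rule psubset.IH)
        show "I - {i0} \<subset> I" using i0 by blast
        show "finite (A i - {a})" if "i \<in> I - {i0}" for i using that finA by auto
        fix K assume K: "K \<subseteq> I - {i0}"
        show "card K \<le> card (\<Union>i\<in>K. A i - {a})"
        proof (cases "K = {}")
          case False
          have "K \<subset> I" using K i0 by blast
          then have "\<not> card (\<Union>i\<in>K. A i) \<le> card K"
            using False \<open>\<not> (\<exists>J\<subset>I. J \<noteq> {} \<and> card (\<Union>i\<in>J. A i) \<le> card J)\<close> by blast
          moreover have "card (\<Union>i\<in>K. A i) \<le> Suc (card ((\<Union>i\<in>K. A i) - {a}))"
            unfolding card_Diff_singleton_if by (cases "card (\<Union>i\<in>K. A i)") auto
          moreover have eq: "(\<Union>i\<in>K. A i - {a}) = (\<Union>i\<in>K. A i) - {a}" by blast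
          ultimately show ?thesis unfolding eq by linarith
        qed auto
      qed
      then obtain g where g: "inj_on g (I - {i0})" "\<forall>i\<in>I - {i0}. g i \<in> A i - {a}" by blast
      have "inj_on (g(i0 := a)) I" using g by (auto simp: inj_on_def)
      moreover have "\<forall>i\<in>I. (g(i0 := a)) i \<in> A i" using g(2) a by auto
      ultimately show ?thesis by blast
    qed auto
  qed
qed

text \<open>Hall's theorem is applied to \<open>c\<close> copies of every index.\<close>

corollary hall_multiple:
  fixes A :: "'i \<Rightarrow> 'a set"
  assumes "finite I" "\<And>i. i \<in> I \<Longrightarrow> finite (A i)"
    and multi: "\<And>J. J \<subseteq> I \<Longrightarrow> c * card J \<le> card (\<Union>i\<in>J. A i)"
  shows "\<exists>P. (\<forall>i\<in>I. P i \<subseteq> A i \<and> card (P i) = c) \<and> (\<forall>i\<in>I. \<forall>j\<in>I. i \<noteq> j \<longrightarrow> P i \<inter> P j = {})"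
proof -
  have "\<exists>f. inj_on f (I \<times> {..<c}) \<and> (\<forall>p\<in>I \<times> {..<c}. f p \<in> A (fst p))"
  proof (rule hall)
    show "finite (I \<times> {..<c})" using assms(1) by simp
    show "finite (A (fst p))" if "p \<in> I \<times> {..<c}" for p using that assms(2) by auto
    fix K assume K: "K \<subseteq> I \<times> {..<c}"
    have I: "fst ` K \<subseteq> I" using K by auto
    have "finite (fst ` K \<times> {..<c})" using finite_subset[OF I assms(1)] by simp
    moreover have "K \<subseteq> fst ` K \<times> {..<c}" using K by force
    ultimately have "card K \<le> card (fst ` K \<times> {..<c})" by (rule card_mono)
    also have "\<dots> \<le> card (\<Union>i\<in>fst ` K. A i)" using multi[OF I] by (simp add: card_cartesian_product mult.commute)
    finally show "card K \<le> card (\<Union>p\<in>K. A (fst p))" by simp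
  qed
  then obtain f where f: "inj_on f (I \<times> {..<c})" "\<forall>p\<in>I \<times> {..<c}. f p \<in> A (fst p)" by blast
  let ?P = "\<lambda>i. (\<lambda>n. f (i, n)) ` {..<c}"
  have "card (?P i) = c" if "i \<in> I" for i
    using f(1) that by (subst card_image) (auto simp: inj_on_def)
  moreover have "?P i \<subseteq> A i" if "i \<in> I" for i using f(2) that by auto
  moreover have "?P i \<inter> ?P j = {}" if "i \<in> I" "j \<in> I" "i \<noteq> j" for i j
    using f(1) that by (auto simp: inj_on_def)
  ultimately show ?thesis by (intro exI[of _ ?P]) simp
qed

text \<open>In a smallest dense set, deleting T destroys at least c card T of the items, which is
  Hall's condition.\<close>
lemma dense_selection:
  fixes supp :: "'e \<Rightarrow> 'v set"
  assumes fin: "finite F" "finite W" "W \<noteq> {}"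
    and ne: "\<forall>e\<in>F. supp e \<noteq> {}"
    and dense: "c * card W \<le> card {e \<in> F. supp e \<subseteq> W}"
  shows "\<exists>W' P. W' \<subseteq> W \<and> W' \<noteq> {} \<and>
    (\<forall>y\<in>W'. P y \<subseteq> {e \<in> F. supp e \<subseteq> W' \<and> y \<in> supp e} \<and> card (P y) = c) \<and>
    (\<forall>y\<in>W'. \<forall>z\<in>W'. y \<noteq> z \<longrightarrow> P y \<inter> P z = {})"
proof -
  let ?in = "\<lambda>W. {e \<in> F. supp e \<subseteq> W}"
  let ?D = "\<lambda>n. \<exists>Y\<subseteq>W. Y \<noteq> {} \<and> card Y = n \<and> c * card Y \<le> card (?in Y)"
  have "?D (card W)" using dense fin by blast
  then have "?D (LEAST n. ?D n)" by (rule LeastI)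
  then obtain Y where Y: "Y \<subseteq> W" "Y \<noteq> {}" "card Y = (LEAST n. ?D n)" "c * card Y \<le> card (?in Y)" by blast
  have finY: "finite Y" using Y(1) fin finite_subset by blast
  \<comment> \<open>\<open>Y\<close> has least size among the nonempty dense sets, so smaller sets
    are sparse; the empty one contains no item because supports are nonempty.\<close>
  have minimal: "card (?in Z) \<le> c * card Z" if "Z \<subset> Y" for Z
  proof (cases "Z = {}")
    case True
    then have none: "?in Z = {}" using ne by auto
    show ?thesis unfolding none by simp
  next
    case False
    have "card Z < card Y" using that finY by (rule psubset_card_mono[rotated])
    then have "\<not> ?D (card Z)" using not_less_Least[of "card Z" ?D] Y(3) by simp
    moreover have "Z \<subseteq> W" using that Y(1) by blast
    ultimately have "\<not> c * card Z \<le> card (?in Z)" using False by blast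
    then show ?thesis by linarith
  qed
  have "\<exists>P. (\<forall>y\<in>Y. P y \<subseteq> {e \<in> ?in Y. y \<in> supp e} \<and> card (P y) = c) \<and>
      (\<forall>y\<in>Y. \<forall>z\<in>Y. y \<noteq> z \<longrightarrow> P y \<inter> P z = {})"
  proof (rule hall_multiple[OF finY])
    show "finite {e \<in> ?in Y. y \<in> supp e}" for y using fin by simp
    fix T assume T: "T \<subseteq> Y"
    show "c * card T \<le> card (\<Union>y\<in>T. {e \<in> ?in Y. y \<in> supp e})"
    proof (cases "T = {}")
      case False
      have destroyed: "(\<Union>y\<in>T. {e \<in> ?in Y. y \<in> supp e}) = ?in Y - ?in (Y - T)" using T by blast
      have "card (?in Y - ?in (Y - T)) = card (?in Y) - card (?in (Y - T))"
        using fin by (intro card_Diff_subset) auto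
      moreover have "card (?in (Y - T)) \<le> c * card (Y - T)" using False T by (intro minimal) blast
      moreover have "c * card (Y - T) + c * card T = c * card Y"
        using T finY card_mono[OF finY T] finite_subset[OF T finY]
        by (simp add: card_Diff_subset add_mult_distrib2[symmetric])
      ultimately show ?thesis unfolding destroyed using Y(4) by linarith
    qed simp
  qed
  then obtain P where P: "\<forall>y\<in>Y. P y \<subseteq> {e \<in> ?in Y. y \<in> supp e} \<and> card (P y) = c"
      "\<forall>y\<in>Y. \<forall>z\<in>Y. y \<noteq> z \<longrightarrow> P y \<inter> P z = {}" by blast
  have "\<forall>y\<in>Y. P y \<subseteq> {e \<in> F. supp e \<subseteq> Y \<and> y \<in> supp e} \<and> card (P y) = c" using P(1) by auto
  then show ?thesis using Y(1,2) P(2) by (intro exI[of _ Y] exI[of _ P] conjI)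
qed

text \<open>Vertices are added one at a time, each to the side that cuts at least half of its edges
  to the earlier ones.\<close>

lemma half_cut:
  fixes ends :: "'e \<Rightarrow> 'v set"
  assumes "finite F" "finite W" "\<And>e. e \<in> F \<Longrightarrow> card (ends e) = 2"
  shows "\<exists>X\<subseteq>W. card {e \<in> F. ends e \<subseteq> W} \<le>
     2 * card {e \<in> F. ends e \<subseteq> W \<and> ends e \<inter> X \<noteq> {} \<and> \<not> ends e \<subseteq> X}"
  using assms(2)
proof (induction W rule: finite_induct)
  case empty
  have none: "{e \<in> F. ends e \<subseteq> {}} = {}" using assms(3) by fastforce
  show ?case unfolding none by simp
next
  case (insert v W)
  let ?in = "\<lambda>W. {e \<in> F. ends e \<subseteq> W}"
  let ?cut = "\<lambda>X W. {e \<in> F. ends e \<subseteq> W \<and> ends e \<inter> X \<noteq> {} \<and> \<not> ends e \<subseteq> X}"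
  let ?new = "{e \<in> F. ends e \<subseteq> insert v W \<and> v \<in> ends e}"
  obtain X where X: "X \<subseteq> W" "card (?in W) \<le> 2 * card (?cut X W)" using insert by blast
  let ?X = "insert v X"
  have new: "\<exists>w. w \<noteq> v \<and> w \<in> W \<and> ends e = {v, w}" if "e \<in> ?new" for e
  proof -
    have "card (ends e) = 2" "v \<in> ends e" "ends e \<subseteq> insert v W" using that assms(3) by auto
    then show ?thesis by (auto simp: card_2_iff)
  qed
  have in_eq: "?in (insert v W) = ?in W \<union> ?new" "?in W \<inter> ?new = {}" using insert.hyps by auto
  have cut1: "?cut X (insert v W) = ?cut X W \<union> (?new \<inter> ?cut X (insert v W))"
    using insert.hyps X(1) by auto
  have cut2: "?cut ?X (insert v W) = ?cut X W \<union> (?new \<inter> ?cut ?X (insert v W))"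
    using insert.hyps X(1) by auto
  have "?new \<subseteq> (?new \<inter> ?cut X (insert v W)) \<union> (?new \<inter> ?cut ?X (insert v W))"
  proof
    fix e assume e: "e \<in> ?new"
    obtain w where w: "w \<noteq> v" "w \<in> W" "ends e = {v, w}" using new[OF e] by blast
    have "v \<notin> X" using X(1) insert.hyps by blast
    then show "e \<in> (?new \<inter> ?cut X (insert v W)) \<union> (?new \<inter> ?cut ?X (insert v W))"
      using e w by (cases "w \<in> X") auto
  qed
  then have "card ?new \<le> card ((?new \<inter> ?cut X (insert v W)) \<union> (?new \<inter> ?cut ?X (insert v W)))"
    using assms(1) by (intro card_mono) auto
  also have "\<dots> \<le> card (?new \<inter> ?cut X (insert v W)) + card (?new \<inter> ?cut ?X (insert v W))"
    by (rule card_Un_le)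
  finally have nle: "card ?new \<le> card (?new \<inter> ?cut X (insert v W)) + card (?new \<inter> ?cut ?X (insert v W))" .
  have c1: "card (?cut X (insert v W)) = card (?cut X W) + card (?new \<inter> ?cut X (insert v W))"
    by (subst cut1, rule card_Un_disjoint) (use assms(1) in_eq in auto)
  have c2: "card (?cut ?X (insert v W)) = card (?cut X W) + card (?new \<inter> ?cut ?X (insert v W))"
    by (subst cut2, rule card_Un_disjoint) (use assms(1) in_eq in auto)
  have "card (?in (insert v W)) = card (?in W) + card ?new"
    unfolding in_eq(1) by (rule card_Un_disjoint) (use assms(1) in_eq in auto)
  then have "card (?in (insert v W)) \<le> 2 * card (?cut X (insert v W)) \<or>
      card (?in (insert v W)) \<le> 2 * card (?cut ?X (insert v W))"
    using c1 c2 nle X(2) by linarith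
  then show ?case
  proof
    assume "card (?in (insert v W)) \<le> 2 * card (?cut X (insert v W))"
    then show ?case using X(1) by (intro exI[of _ X]) auto
  next
    assume "card (?in (insert v W)) \<le> 2 * card (?cut ?X (insert v W))"
    then show ?case using X(1) by (intro exI[of _ ?X]) auto
  qed
qed

section \<open>Line graphs of multigraphs\<close>

text \<open>The kernel is a stable matching: each edge e prefers edges of larger rank at its two ends.\<close>
lemma has_kernel_of_ranks:
  fixes D :: "'a \<Rightarrow> 'a \<Rightarrow> nat" and px :: "'a \<Rightarrow> 'b" and py :: "'a \<Rightarrow> 'c" and k l :: "'a \<Rightarrow> nat"
  assumes "finite T"
    and D: "\<And>e f. e \<in> T \<Longrightarrow> f \<in> T \<Longrightarrow> D e f > 0 \<longleftrightarrow> (px e = px f \<and> k e < k f) \<or> (py e = py f \<and> l e < l f)"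
    and inj: "\<And>e f. e \<in> T \<Longrightarrow> f \<in> T \<Longrightarrow> e \<noteq> f \<Longrightarrow> py e = py f \<Longrightarrow> l e \<noteq> l f"
  shows "has_kernel D T"
  using assms
proof (induction T rule: finite_psubset_induct)
  case (psubset T)
  note D = psubset.prems(1) and inj = psubset.prems(2)
  \<comment> \<open>\<open>Top\<close> consists of the favourites of the \<open>px\<close> ends. If
    two of them compete at a \<open>py\<close> end, the worse one can be removed: nothing beats
    \<open>f\<close> at its \<open>px\<close> end, so a kernel of the rest contains \<open>f\<close>
    or an edge better than \<open>f\<close> at that \<open>py\<close> end. Without competition
    \<open>Top\<close> itself is a kernel.\<close>
  define Top where "Top = {e \<in> T. \<forall>e'\<in>T. px e' = px e \<longrightarrow> k e' \<le> k e}"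
  show ?case
  proof (cases "\<exists>e\<in>Top. \<exists>f\<in>Top. py e = py f \<and> l e < l f")
    case True
    then obtain e f where ef: "e \<in> Top" "f \<in> Top" "py e = py f" "l e < l f" by blast
    then have T: "e \<in> T" "f \<in> T" "e \<noteq> f" by (auto simp: Top_def)
    have "has_kernel D (T - {e})"
      by (rule psubset.IH) (use T D inj in auto)
    then obtain I where I: "I \<subseteq> T - {e}" "\<forall>x\<in>I. \<forall>y\<in>I. D x y = 0" "\<forall>x\<in>T - {e} - I. \<exists>y\<in>I. D x y > 0"
      by (auto simp: has_kernel_def)
    have "\<exists>y\<in>I. D e y > 0"
    proof (cases "f \<in> I")
      case True
      then show ?thesis using D[OF T(1,2)] ef by auto
    next
      case False
      then obtain g where g: "g \<in> I" "D f g > 0" using I(3) T by auto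
      then have gT: "g \<in> T" using I(1) by auto
      have "\<not> (px f = px g \<and> k f < k g)" using ef(2) gT by (fastforce simp: Top_def)
      then have "py f = py g" "l f < l g" using D[OF T(2) gT] g(2) by auto
      then have "D e g > 0" using D[OF T(1) gT] ef by auto
      then show ?thesis using g(1) by blast
    qed
    then show ?thesis unfolding has_kernel_def using I by (intro exI[of _ I]) blast
  next
    case False
    have "D x y = 0" if xy: "x \<in> Top" "y \<in> Top" for x y
    proof -
      have "x \<in> T" "y \<in> T" "\<not> (px x = px y \<and> k x < k y)" using xy by (fastforce simp: Top_def)+
      then show ?thesis using D[of x y] False xy by blast
    qed
    moreover have "\<exists>y\<in>Top. D x y > 0" if x: "x \<in> T - Top" for x
    proof -
      let ?P = "{e \<in> T. px e = px x}"
      have fin: "finite (k ` ?P)" "k ` ?P \<noteq> {}" using psubset.hyps x by auto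
      obtain y where y: "y \<in> ?P" "k y = Max (k ` ?P)" using Max_in[OF fin] by auto
      have max: "k e \<le> k y" if "e \<in> T" "px e = px x" for e
        using that fin y by (simp add: Max_ge)
      then have "y \<in> Top" using y by (auto simp: Top_def)
      moreover obtain e where "e \<in> T" "px e = px x" "k x < k e" using x by (auto simp: Top_def not_le)
      with max[of e] have "k x < k y" by simp
      ultimately show ?thesis using D[of x y] x y by auto
    qed
    ultimately show ?thesis unfolding has_kernel_def
      by (intro exI[of _ Top]) (auto simp: Top_def)
  qed
qed

locale line_multigraph =
  fixes E :: "'a set" and ends :: "'a \<Rightarrow> 'b set" and adj :: "'a \<Rightarrow> 'a \<Rightarrow> bool"
  assumes finite_E: "finite E"
    and card_ends: "e \<in> E \<Longrightarrow> card (ends e) = 2"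
    and adj_iff: "adj e f \<longleftrightarrow> e \<in> E \<and> f \<in> E \<and> e \<noteq> f \<and> ends e \<inter> ends f \<noteq> {}"
begin

text \<open>At each end v, edges of smaller level are worse, and ties are broken arbitrarily.  Every
  edge that is worse than e at the only end it shares with e is a neighbour of e that costs
  no out-degree at e.\<close>
lemma is_KP_of_levels:
  fixes lev :: "'b \<Rightarrow> 'a \<Rightarrow> nat" and f :: "'a \<Rightarrow> int"
  assumes S: "S \<subseteq> E"
    and bip: "\<And>e. e \<in> S \<Longrightarrow> \<exists>x y. ends e = {x, y} \<and> x \<in> X \<and> y \<notin> X"
    and f: "\<And>e. e \<in> S \<Longrightarrow> int (deg S (induced adj S) e) <
        f e + int (card {e' \<in> S. \<exists>v. ends e \<inter> ends e' = {v} \<and> lev v e' < lev v e})"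
  shows "is_KP S (induced adj S) f"
proof -
  have finS: "finite S" using S finite_E finite_subset by auto
  have "\<forall>e\<in>S. \<exists>x. \<exists>y. ends e = {x, y} \<and> x \<in> X \<and> y \<notin> X" using bip by blast
  then obtain px where "\<forall>e\<in>S. \<exists>y. ends e = {px e, y} \<and> px e \<in> X \<and> y \<notin> X"
    unfolding bchoice_iff by blast
  then obtain py where "\<forall>e\<in>S. ends e = {px e, py e} \<and> px e \<in> X \<and> py e \<notin> X"
    unfolding bchoice_iff by blast
  then have pxy: "ends e = {px e, py e}" "px e \<in> X" "py e \<notin> X" if "e \<in> S" for e using that by blast+
  obtain idx :: "'a \<Rightarrow> nat" and N where "idx ` S = {i. i < N}" and idx_inj: "inj_on idx S"
    using finite_imp_inj_to_nat_seg[OF finS] by blast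
  then have idx: "inj_on idx S" "\<And>e. e \<in> S \<Longrightarrow> idx e < N" by auto
  \<comment> \<open>Since \<open>idx e < N\<close>, the level decides and the index only breaks
    ties.\<close>
  define key where "key = (\<lambda>v e. lev v e * N + idx e)"
  have key_less: "key v e < key v e'" if lt: "lev v e < lev v e'" and "e \<in> S" for v e e'
  proof -
    have "key v e < Suc (lev v e) * N" using idx(2)[OF \<open>e \<in> S\<close>] by (simp add: key_def)
    also have "\<dots> \<le> lev v e' * N" using lt by (intro mult_right_mono) auto
    finally show ?thesis by (simp add: key_def)
  qed
  have key_inj: "key v e \<noteq> key v e'" if ne: "e \<noteq> e'" and S: "e \<in> S" "e' \<in> S" for v e e'
  proof
    assume eq: "key v e = key v e'"
    then have "lev v e = lev v e'" using key_less[of v e e'] key_less[of v e' e] S by force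
    then have "idx e = idx e'" using eq by (simp add: key_def)
    then show False using idx(1) ne S by (auto dest: inj_onD)
  qed
  \<comment> \<open>Parallel edges may prefer each other at different ends, and then arcs run both
    ways; agreement at both ends still gives a single arc.\<close>
  define D where "D = (\<lambda>e e'. if e \<in> S \<and> e' \<in> S \<and> (\<exists>v\<in>ends e \<inter> ends e'. key v e < key v e') then 1 else 0 :: nat)"
  have D_iff: "D e e' > 0 \<longleftrightarrow> (px e = px e' \<and> key (px e) e < key (px e') e') \<or>
      (py e = py e' \<and> key (py e) e < key (py e') e')" if "e \<in> S" "e' \<in> S" for e e'
  proof -
    have "px e \<noteq> py e'" "py e \<noteq> px e'" using pxy(2,3)[OF that(1)] pxy(2,3)[OF that(2)] by metis+
    then have *: "ends e \<inter> ends e' = {v. (v = px e \<and> px e = px e') \<or> (v = py e \<and> py e = py e')}"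
      unfolding pxy(1)[OF that(1)] pxy(1)[OF that(2)] by blast
    have "(\<exists>v\<in>ends e \<inter> ends e'. key v e < key v e') \<longleftrightarrow> (px e = px e' \<and> key (px e) e < key (px e') e') \<or>
      (py e = py e' \<and> key (py e) e < key (py e') e')"
      unfolding * by (simp only: bex_simps mem_Collect_eq Bex_def) metis
    then show ?thesis using that by (simp add: D_def)
  qed
  have kp: "kernel_perfect S D"
    unfolding kernel_perfect_def
  proof (intro allI impI)
    fix T assume T: "T \<subseteq> S"
    show "has_kernel D T"
    proof (rule has_kernel_of_ranks[of T D px "\<lambda>e. key (px e) e" py "\<lambda>e. key (py e) e"])
      show "finite T" by (rule finite_subset[OF T finS])
    next
      fix e f assume "e \<in> T" "f \<in> T"
      then show "D e f > 0 \<longleftrightarrow> (px e = px f \<and> key (px e) e < key (px f) f) \<or> (py e = py f \<and> key (py e) e < key (py f) f)"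
        using T by (intro D_iff) auto
    next
      fix e f assume "e \<in> T" "f \<in> T" "e \<noteq> f" "py e = py f"
      then show "key (py e) e \<noteq> key (py f) f" using T key_inj[of e f "py f"] by auto
    qed
  qed
  have arcs: "\<forall>u v. D u v > 0 \<longrightarrow> u \<in> S \<and> v \<in> S \<and> u \<noteq> v"
    by (auto simp: D_def)
  have cov: "\<forall>u v. induced adj S u v \<longrightarrow> D u v + D v u > 0"
  proof (intro allI impI)
    fix u v assume uv: "induced adj S u v"
    then obtain w where w: "w \<in> ends u \<inter> ends v" "u \<in> S" "v \<in> S" "u \<noteq> v" by (auto simp: induced_def adj_iff)
    then have "key w u < key w v \<or> key w v < key w u" using key_inj[of u v w] by linarith
    then show "D u v + D v u > 0" using w by (auto simp: D_def)
  qed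
  have "int (\<Sum>e'\<in>S. D e e') < f e" if e: "e \<in> S" for e
  proof -
    let ?P = "{e' \<in> S. \<exists>v. ends e \<inter> ends e' = {v} \<and> lev v e' < lev v e}"
    let ?O = "{e' \<in> S. \<exists>v\<in>ends e \<inter> ends e'. key v e < key v e'}"
    have "(\<Sum>e'\<in>S. D e e') = card ?O" using finS e by (simp add: D_def sum.If_cases Int_def)
    moreover have "?O \<inter> ?P = {}"
    proof -
      have False if "e' \<in> S" "ends e \<inter> ends e' = {v}" "lev v e' < lev v e" "w \<in> ends e \<inter> ends e'" "key w e < key w e'" for e' v w
        using that key_less[OF that(3,1)] by auto
      then show ?thesis by blast
    qed
    moreover have "?O \<union> ?P \<subseteq> {e' \<in> S. induced adj S e e'}"
    proof -
      have "e' \<noteq> e" if "e' \<in> ?O \<union> ?P" for e' using that by auto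
      then show ?thesis using e S by (auto simp: induced_def adj_iff)
    qed
    then have "card (?O \<union> ?P) \<le> deg S (induced adj S) e"
      unfolding deg_def using finS by (intro card_mono) auto
    ultimately have "(\<Sum>e'\<in>S. D e e') + card ?P \<le> deg S (induced adj S) e"
      using finS by (simp add: card_Un_disjoint)
    then show ?thesis using f[OF e] by linarith
  qed
  then show ?thesis unfolding is_KP_def using arcs cov kp by blast
qed

end

text \<open>A counterexample to the common statement behind both claims, to be shown to have no
  edges.\<close>

locale irreducible_line_multigraph = line_multigraph E ends adj
  for E :: "'a set" and ends :: "'a \<Rightarrow> 'b set" and adj :: "'a \<Rightarrow> 'a \<Rightarrow> bool" +
  fixes k :: nat
  assumes clique_le: "K \<subseteq> E \<Longrightarrow> is_clique adj K \<Longrightarrow> card K \<le> k"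
    and deg_le: "e \<in> E \<Longrightarrow> deg E adj e \<le> k + 1"
    and k_ge: "68 \<le> k"
    and irreducible: "S \<subseteq> E \<Longrightarrow> S \<noteq> {} \<Longrightarrow>
      (\<And>e. f e = int (deg S (induced adj S) e) + int k - int (deg E adj e)) \<Longrightarrow>
      \<not> is_AT S (induced adj S) f \<and> \<not> is_KP S (induced adj S) f"
begin

section \<open>Degrees and multiplicities in a counterexample\<close>

definition mdeg :: "'b \<Rightarrow> nat" where
  "mdeg x = card {e \<in> E. x \<in> ends e}"

definition mult :: "'a \<Rightarrow> nat" where
  "mult e = card {f \<in> E. ends f = ends e}"

text \<open>The number of neighbours that must not be out-neighbours of e in a reducible subgraph.\<close>
definition need :: "'a \<Rightarrow> nat" where
  "need e = deg E adj e + 1 - k"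

text \<open>These neighbours are certainly not out-neighbours of \<open>e\<close> in the orientation
  given by the levels.\<close>

definition worse :: "'a set \<Rightarrow> ('b \<Rightarrow> 'a \<Rightarrow> nat) \<Rightarrow> 'a \<Rightarrow> 'a set" where
  "worse S lev e = {e' \<in> S. \<exists>v. ends e \<inter> ends e' = {v} \<and> lev v e' < lev v e}"

lemma endsE:
  assumes "e \<in> E"
  obtains x y where "ends e = {x, y}" "x \<noteq> y"
  using card_ends[OF assms] by (auto simp: card_2_iff)

lemma ends_eq: "f \<in> E \<Longrightarrow> x \<in> ends f \<Longrightarrow> y \<in> ends f \<Longrightarrow> x \<noteq> y \<Longrightarrow> ends f = {x, y}"
  using card_ends[of f] by (auto simp: card_2_iff)

lemma other_end:
  assumes "f \<in> E" "x \<in> ends f"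
  obtains y where "ends f = {x, y}" "x \<noteq> y"
proof -
  obtain a b where "ends f = {a, b}" "a \<noteq> b" using endsE[OF assms(1)] .
  then show thesis using assms(2) that[of b] that[of a] by (auto simp: insert_commute)
qed

text \<open>A vertex of smaller degree would be reducible by itself: without arcs it only needs a
  positive value of \<open>f\<close>.\<close>

lemma deg_ge: assumes e: "e \<in> E" shows "k \<le> deg E adj e"
proof (rule ccontr)
  assume lt: "\<not> k \<le> deg E adj e"
  let ?f = "\<lambda>e'. int (deg {e} (induced adj {e}) e') + int k - int (deg E adj e')"
  obtain x y where xy: "ends e = {x, y}" "x \<noteq> y" using endsE[OF e] .
  have "deg {e} (induced adj {e}) e = 0" by (auto simp: deg_def induced_def adj_iff)
  then have "is_KP {e} (induced adj {e}) ?f"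
    using e xy lt by (intro is_KP_of_levels[where X = "{x}" and lev = "\<lambda>_ _. 0"]) auto
  then show False using irreducible[of "{e}" ?f] e by simp
qed

text \<open>This sets \<open>is_KP_of_levels\<close> against irreducibility. The bipartite arguments
  below choose levels that violate it.\<close>

lemma few_worse_than_need:
  assumes "S \<subseteq> E" "S \<noteq> {}"
    and "\<And>e. e \<in> S \<Longrightarrow> \<exists>x y. ends e = {x, y} \<and> x \<in> X \<and> y \<notin> X"
  shows "\<exists>e\<in>S. card (worse S lev e) < need e"
proof (rule ccontr)
  assume *: "\<not> ?thesis"
  let ?f = "\<lambda>e. int (deg S (induced adj S) e) + int k - int (deg E adj e)"
  have "is_KP S (induced adj S) ?f"
  proof (rule is_KP_of_levels[OF assms(1,3)])
    fix e assume e: "e \<in> S"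
    then have "need e \<le> card (worse S lev e)" using * by (auto simp: not_less)
    then have "int (deg E adj e) < int k + int (card (worse S lev e))"
      using deg_ge[of e] e assms(1) unfolding need_def by auto
    then show "int (deg S (induced adj S) e) < ?f e +
        int (card {e' \<in> S. \<exists>v. ends e \<inter> ends e' = {v} \<and> lev v e' < lev v e})"
      by (simp add: worse_def)
  qed
  then show False using irreducible[OF assms(1,2), of ?f] by simp
qed

lemma need_le: "e \<in> E \<Longrightarrow> need e \<le> 2"
  using deg_le[of e] by (simp add: need_def)

lemma finite_edges: "finite {e \<in> E. P e}" using finite_E by simp

lemma finite_worse: "S \<subseteq> E \<Longrightarrow> finite (worse S lev e)"
  using finite_E finite_subset[of S E] by (auto simp: worse_def)

text \<open>The edges at \<open>x\<close> or \<open>y\<close> are \<open>e\<close> and its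
  neighbours, and the edges at both are the class of \<open>e\<close>.\<close>

lemma mdeg_add_mdeg:
  assumes e: "e \<in> E" "ends e = {x, y}" "x \<noteq> y"
  shows "mdeg x + mdeg y = deg E adj e + mult e + 1"
proof -
  let ?x = "{f \<in> E. x \<in> ends f}" and ?y = "{f \<in> E. y \<in> ends f}"
  have "ends f = ends e" if "f \<in> E" "x \<in> ends f" "y \<in> ends f" for f
    using ends_eq[OF that e(3)] e(2) by simp
  then have "?x \<inter> ?y = {f \<in> E. ends f = ends e}" using e(2) by blast
  moreover have "ends e \<inter> ends f \<noteq> {} \<longleftrightarrow> x \<in> ends f \<or> y \<in> ends f" for f using e(2) by simp
  then have "?x \<union> ?y = insert e {f \<in> E. adj e f}" using e(1,2) by (auto simp only: adj_iff)
  moreover have "e \<notin> {f \<in> E. adj e f}" by (simp add: adj_iff)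
  ultimately show ?thesis
    using card_Un_Int[of ?x ?y] finite_edges by (simp add: mdeg_def mult_def deg_def)
qed

text \<open>The edges at a vertex form a clique.\<close>

lemma mdeg_le: "mdeg x \<le> k"
  unfolding mdeg_def by (rule clique_le) (auto simp: is_clique_def adj_iff)

text \<open>The degree formula gives \<open>mdeg x - mult e = deg E adj e + 1 - mdeg y\<close>, and
  \<open>mdeg y\<close> is at most \<open>k\<close>.\<close>

lemma need_le_others:
  assumes e: "e \<in> E" "x \<in> ends e"
  shows "need e \<le> card {f \<in> E. x \<in> ends f \<and> ends f \<noteq> ends e}"
proof -
  obtain y where y: "ends e = {x, y}" "x \<noteq> y" using other_end[OF e] .
  have "{f \<in> E. x \<in> ends f} = {f \<in> E. x \<in> ends f \<and> ends f \<noteq> ends e} \<union> {f \<in> E. ends f = ends e}"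
    using e by auto
  then have "mdeg x = card {f \<in> E. x \<in> ends f \<and> ends f \<noteq> ends e} + mult e"
    unfolding mdeg_def mult_def using finite_edges by (subst card_Un_disjoint[symmetric]) auto
  then show ?thesis using mdeg_add_mdeg[OF e(1) y] mdeg_le[of y] by (simp add: need_def)
qed

lemma need_parallel:
  assumes "e \<in> E" "f \<in> E" "ends f = ends e"
  shows "need f = need e"
proof -
  obtain x y where "ends e = {x, y}" "x \<noteq> y" using endsE[OF assms(1)] .
  then have "deg E adj f + mult f = deg E adj e + mult e"
    using mdeg_add_mdeg[of e x y] mdeg_add_mdeg[of f x y] assms by simp
  then show ?thesis using assms(3) by (simp add: need_def mult_def)
qed

text \<open>Otherwise a cut keeps at least four edges inside \<open>W\<close> per vertex, and
  \<open>dense_selection\<close> yields disjoint sets \<open>P y\<close> of four edges, placed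
  lowest at \<open>y\<close>. Each edge of \<open>S\<close> lies outside \<open>P z\<close> for one
  of its ends \<open>z\<close>; at most two edges of \<open>P z\<close> are parallel to it, and the
  remaining two or more are worse.\<close>

lemma edges_in_lt:
  assumes mult3: "\<And>e. e \<in> E \<Longrightarrow> mult e \<le> 3" and W: "finite W" "W \<noteq> {}"
  shows "card {e \<in> E. ends e \<subseteq> W} < 8 * card W"
proof (rule ccontr)
  assume "\<not> ?thesis"
  moreover obtain X where X: "X \<subseteq> W" "card {e \<in> E. ends e \<subseteq> W} \<le>
     2 * card {e \<in> E. ends e \<subseteq> W \<and> ends e \<inter> X \<noteq> {} \<and> \<not> ends e \<subseteq> X}"
    using half_cut[OF finite_E W(1), of ends] card_ends by auto
  moreover define F where "F = {e \<in> E. ends e \<inter> X \<noteq> {} \<and> \<not> ends e \<subseteq> X}"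
  moreover have "{e \<in> E. ends e \<subseteq> W \<and> ends e \<inter> X \<noteq> {} \<and> \<not> ends e \<subseteq> X} = {e \<in> F. ends e \<subseteq> W}"
    by (auto simp: F_def)
  ultimately have dense: "4 * card W \<le> card {e \<in> F. ends e \<subseteq> W}" by simp
  have "finite F" using finite_E by (simp add: F_def)
  have ends_ne: "\<forall>e\<in>F. ends e \<noteq> {}" by (auto simp: F_def)
  from dense_selection[OF \<open>finite F\<close> W ends_ne dense]
  obtain Y P where YP: "Y \<subseteq> W \<and> Y \<noteq> {} \<and>
    (\<forall>y\<in>Y. P y \<subseteq> {e \<in> F. ends e \<subseteq> Y \<and> y \<in> ends e} \<and> card (P y) = 4) \<and>
    (\<forall>y\<in>Y. \<forall>z\<in>Y. y \<noteq> z \<longrightarrow> P y \<inter> P z = {})"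
    by (elim exE)
  then have Y: "Y \<subseteq> W" "Y \<noteq> {}"
    "\<And>y. y \<in> Y \<Longrightarrow> P y \<subseteq> {e \<in> F. ends e \<subseteq> Y \<and> y \<in> ends e}"
    "\<And>y. y \<in> Y \<Longrightarrow> card (P y) = 4"
    "\<And>y z. y \<in> Y \<Longrightarrow> z \<in> Y \<Longrightarrow> y \<noteq> z \<Longrightarrow> P y \<inter> P z = {}"
    by simp_all
  define S where "S = {e \<in> F. ends e \<subseteq> Y}"
  have SE: "S \<subseteq> E" by (auto simp: S_def F_def)
  obtain y where y: "y \<in> Y" using Y(2) by blast
  then have "P y \<noteq> {}" using Y(4)[OF y] by auto
  then have S_ne: "S \<noteq> {}" using Y(3)[OF y] by (auto simp: S_def)
  have bip: "\<exists>x y. ends e = {x, y} \<and> x \<in> X \<and> y \<notin> X" if e: "e \<in> S" for e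
  proof -
    have eX: "e \<in> E" "ends e \<inter> X \<noteq> {}" "\<not> ends e \<subseteq> X" using e by (auto simp: S_def F_def)
    then obtain x where x: "x \<in> ends e" "x \<in> X" by blast
    obtain y where y: "ends e = {x, y}" "x \<noteq> y" using other_end[OF eX(1) x(1)] .
    then have "y \<notin> X" using x(2) eX(3) by simp
    then show ?thesis using y(1) x(2) by (intro exI conjI)
  qed
  define lev :: "'b \<Rightarrow> 'a \<Rightarrow> nat" where "lev = (\<lambda>y e. if e \<in> P y then 0 else 1)"
  have "\<exists>e\<in>S. card (worse S lev e) < need e"
    by (rule few_worse_than_need[OF SE S_ne bip])
  then obtain e where e: "e \<in> S" "card (worse S lev e) < need e" by blast
  let ?w = "worse S lev e"
  have eE: "e \<in> E" using e(1) SE by blast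
  obtain a b where ab: "ends e = {a, b}" "a \<noteq> b" using endsE[OF eE] .
  then have abY: "a \<in> Y" "b \<in> Y" using e(1) by (auto simp: S_def)
  then have "e \<notin> P a \<or> e \<notin> P b" using Y(5)[OF abY ab(2)] by blast
  then obtain z where z: "z \<in> ends e" "z \<in> Y" "e \<notin> P z" using ab abY by blast
  let ?par = "{f \<in> E. ends f = ends e} - {e}"
  have "P z - ?par \<subseteq> ?w"
  proof
    fix f assume f: "f \<in> P z - ?par"
    then have fS: "f \<in> S" "z \<in> ends f" "f \<noteq> e" using Y(3)[OF z(2)] z(3) by (auto simp: S_def)
    then have "f \<in> E" "ends f \<noteq> ends e" using f SE by auto
    then have "ends e \<inter> ends f = {z}" using fS(2) z(1) ends_eq[of f z] ends_eq[OF eE, of z] by blast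
    then show "f \<in> ?w" using fS(1) f z(3) by (auto simp: worse_def lev_def)
  qed
  then have "card (P z - ?par) \<le> card ?w" using finite_worse[OF SE] by (intro card_mono)
  moreover have "card ?par \<le> 2" using mult3[OF eE] eE finite_edges by (simp add: mult_def card_Diff_singleton)
  moreover have "card (P z) - card ?par \<le> card (P z - ?par)"
    using finite_edges by (intro diff_card_le_card_Diff) auto
  ultimately have "2 \<le> card ?w" using Y(4)[OF z(2)] by linarith
  then show False using need_le[OF eE] e(2) by linarith
qed

section \<open>Vertices of low degree and the final count\<close>

definition nbrs :: "'b \<Rightarrow> 'b set" where
  "nbrs x = {y. x \<noteq> y \<and> (\<exists>e\<in>E. ends e = {x, y})}"

lemma finite_ends: "finite (\<Union>e\<in>E. ends e)"
  using finite_E card_ends by (metis card.infinite finite_UN_I zero_neq_numeral)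

text \<open>Otherwise \<open>dense_selection\<close>, with the vertices of \<open>L\<close> as
  items, assigns two private vertices \<open>P y\<close> of \<open>L\<close> to each
  \<open>y\<close> in \<open>Y\<close>. For \<open>x\<close> in \<open>P y\<close> one edge
  \<open>q y x\<close> is placed lowest at \<open>y\<close>. An edge from \<open>x\<close> to
  \<open>y\<close> has both of these below it at \<open>y\<close> if \<open>x\<close> is not in
  \<open>P y\<close>; otherwise all edges from \<open>x\<close> to other vertices are below it at
  \<open>x\<close>, which is enough by \<open>need_le_others\<close>.\<close>

lemma low_card_lt:
  assumes L: "finite L" "L \<noteq> {}" "L \<subseteq> (\<Union>e\<in>E. ends e)" and disj: "\<And>x. x \<in> L \<Longrightarrow> nbrs x \<inter> L = {}"
  shows "card L < 2 * card (\<Union>x\<in>L. nbrs x)"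
proof (rule ccontr)
  assume not_lt: "\<not> ?thesis"
  let ?R = "\<Union>x\<in>L. nbrs x"
  have inR: "{x \<in> L. nbrs x \<subseteq> ?R} = L" by auto
  have dense: "2 * card ?R \<le> card {x \<in> L. nbrs x \<subseteq> ?R}" using not_lt by (simp only: inR not_less)
  have "?R \<subseteq> (\<Union>e\<in>E. ends e)" by (auto simp: nbrs_def)
  then have finR: "finite ?R" using finite_ends finite_subset by blast
  have nonempty: "nbrs x \<noteq> {}" if x: "x \<in> L" for x
  proof -
    obtain e where e: "e \<in> E" "x \<in> ends e" using x L(3) by blast
    obtain y where "ends e = {x, y}" "x \<noteq> y" using other_end[OF e] .
    then show ?thesis using e(1) by (auto simp: nbrs_def)
  qed
  then have "?R \<noteq> {}" using L(2) by blast
  have nonempty': "\<forall>x\<in>L. nbrs x \<noteq> {}" using nonempty by blast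
  from dense_selection[OF L(1) finR \<open>?R \<noteq> {}\<close> nonempty' dense]
  obtain Y P where YP: "Y \<subseteq> ?R \<and> Y \<noteq> {} \<and>
    (\<forall>y\<in>Y. P y \<subseteq> {x \<in> L. nbrs x \<subseteq> Y \<and> y \<in> nbrs x} \<and> card (P y) = 2) \<and>
    (\<forall>y\<in>Y. \<forall>z\<in>Y. y \<noteq> z \<longrightarrow> P y \<inter> P z = {})"
    by (elim exE)
  then have Y: "Y \<subseteq> ?R" "Y \<noteq> {}"
    "\<And>y. y \<in> Y \<Longrightarrow> P y \<subseteq> {x \<in> L. nbrs x \<subseteq> Y \<and> y \<in> nbrs x}"
    "\<And>y. y \<in> Y \<Longrightarrow> card (P y) = 2"
    "\<And>y z. y \<in> Y \<Longrightarrow> z \<in> Y \<Longrightarrow> y \<noteq> z \<Longrightarrow> P y \<inter> P z = {}"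
    by simp_all
  have YL: "Y \<inter> L = {}" using Y(1) disj by blast
  define X where "X = {x \<in> L. nbrs x \<subseteq> Y}"
  define S where "S = {e \<in> E. ends e \<inter> X \<noteq> {}}"
  have SE: "S \<subseteq> E" by (auto simp: S_def)
  have S_ends: "\<exists>x y. ends e = {x, y} \<and> x \<in> X \<and> y \<in> Y" if e: "e \<in> S" for e
  proof -
    obtain x where x: "e \<in> E" "x \<in> X" "x \<in> ends e" using e by (auto simp: S_def)
    obtain y where y: "ends e = {x, y}" "x \<noteq> y" using other_end[OF x(1,3)] .
    then have "y \<in> nbrs x" using x(1) by (auto simp: nbrs_def intro!: bexI[of _ e])
    then have "y \<in> Y" using x(2) by (auto simp: X_def)
    then show ?thesis using y(1) x(2) by (intro exI conjI)
  qed
  define q where "q = (\<lambda>y x. SOME e. e \<in> E \<and> ends e = {x, y})"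
  have q: "q y x \<in> E" "ends (q y x) = {x, y}" if "y \<in> Y" "x \<in> P y" for x y
  proof -
    have "y \<in> nbrs x" using subsetD[OF Y(3)[OF that(1)] that(2)] by simp
    then have "\<exists>e. e \<in> E \<and> ends e = {x, y}" unfolding nbrs_def mem_Collect_eq Bex_def by (elim conjE)
    then have "q y x \<in> E \<and> ends (q y x) = {x, y}" unfolding q_def by (rule someI_ex)
    then show "q y x \<in> E" "ends (q y x) = {x, y}" by blast+
  qed
  have PX: "P y \<subseteq> X" if "y \<in> Y" for y using Y(3)[OF that] by (auto simp: X_def)
  have XY: "X \<inter> Y = {}" using YL by (auto simp: X_def)
  \<comment> \<open>At a vertex of \<open>X\<close> the level favours the whole parallel class
    leading to the \<open>y\<close> that owns it.\<close>
  define lev :: "'b \<Rightarrow> 'a \<Rightarrow> nat" where "lev = (\<lambda>v e. if v \<in> Y then (if e \<in> q v ` P v then 0 else 1)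
     else if \<exists>y\<in>Y. v \<in> P y \<and> ends e = {v, y} then 1 else 0)"
  obtain y0 where y0: "y0 \<in> Y" using Y(2) by blast
  then have "P y0 \<noteq> {}" using Y(4)[OF y0] by auto
  then obtain x0 where x0: "x0 \<in> P y0" by blast
  have "q y0 x0 \<in> S" using q[OF y0 x0] PX[OF y0] x0 by (auto simp: S_def)
  then have S_ne: "S \<noteq> {}" by blast
  have bip: "\<exists>x y. ends e = {x, y} \<and> x \<in> X \<and> y \<notin> X" if "e \<in> S" for e
    using S_ends[OF that] XY by blast
  have "\<exists>e\<in>S. card (worse S lev e) < need e"
    by (rule few_worse_than_need[OF SE S_ne bip])
  then obtain e where e: "e \<in> S" "card (worse S lev e) < need e" by blast
  have eE: "e \<in> E" using e(1) SE by blast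
  obtain x y where xy: "ends e = {x, y}" "x \<in> X" "y \<in> Y" using S_ends[OF e(1)] by blast
  have "x \<noteq> y" using xy XY by blast
  have xnY: "x \<notin> Y" using xy XY by blast
  show False
  proof (cases "x \<in> P y")
    case True
    have "{f \<in> E. x \<in> ends f \<and> ends f \<noteq> ends e} \<subseteq> worse S lev e"
    proof
      fix f assume "f \<in> {f \<in> E. x \<in> ends f \<and> ends f \<noteq> ends e}"
      then have f: "f \<in> E" "x \<in> ends f" "ends f \<noteq> ends e" by auto
      have "y \<notin> ends f" using ends_eq[OF f(1,2)] \<open>x \<noteq> y\<close> f(3) xy(1) by blast
      then have "ends e \<inter> ends f = {x}" using xy(1) f(2) by blast
      moreover have "lev x e = 1" using True xy xnY by (auto simp: lev_def)
      moreover have "\<not> (\<exists>y'\<in>Y. x \<in> P y' \<and> ends f = {x, y'})"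
        using Y(5)[of _ y] True xy(1,3) f(3) by blast
      then have "lev x f = 0" using xnY by (simp add: lev_def)
      ultimately show "f \<in> worse S lev e" using f xy(2) by (auto simp: worse_def S_def)
    qed
    then have "card {f \<in> E. x \<in> ends f \<and> ends f \<noteq> ends e} \<le> card (worse S lev e)"
      using finite_worse[OF SE] by (intro card_mono)
    then show False using need_le_others[OF eE, of x] xy(1) e(2) by simp
  next
    case False
    have ends_q: "x \<notin> ends (q y x')" "y \<in> ends (q y x')" "q y x' \<in> S" if x': "x' \<in> P y" for x'
    proof -
      have "x' \<noteq> x" using False x' by blast
      then show "x \<notin> ends (q y x')" "y \<in> ends (q y x')" "q y x' \<in> S"
        using q[OF xy(3) x'] \<open>x \<noteq> y\<close> PX[OF xy(3)] x' by (auto simp: S_def)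
    qed
    then have "e \<notin> q y ` P y" using xy(1) by blast
    then have lev_e: "lev y e = 1" using xy(3) by (simp add: lev_def)
    have "q y ` P y \<subseteq> worse S lev e"
    proof
      fix f assume f: "f \<in> q y ` P y"
      then have "ends e \<inter> ends f = {y}" "f \<in> S" using ends_q xy(1) by auto
      moreover have "lev y f = 0" using f xy(3) by (simp add: lev_def)
      ultimately show "f \<in> worse S lev e" using lev_e by (auto simp: worse_def)
    qed
    then have "card (q y ` P y) \<le> card (worse S lev e)" using finite_worse[OF SE] by (intro card_mono)
    moreover have "inj_on (q y) (P y)"
    proof (rule inj_onI)
      fix a b assume ab: "a \<in> P y" "b \<in> P y" "q y a = q y b"
      then have "{a, y} = {b, y}" using q(2)[OF xy(3)] by metis
      then show "a = b" by (metis doubleton_eq_iff)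
    qed
    ultimately have "2 \<le> card (worse S lev e)" using Y(4)[OF xy(3)] by (simp add: card_image)
    then show False using need_le[OF eE] e(2) by linarith
  qed
qed

text \<open>The degrees are summed over the vertices \<open>R\<close> of degree at least 16.
  \<open>R1\<close> is the set of neighbours of low vertices, whose degrees are much larger.\<close>

lemma no_edges_of_mult_le:
  assumes mult3: "\<And>e. e \<in> E \<Longrightarrow> mult e \<le> 3"
  shows "E = {}"
proof (rule ccontr)
  assume ne: "E \<noteq> {}"
  define VH where "VH = (\<Union>e\<in>E. ends e)"
  define L where "L = {x \<in> VH. mdeg x \<le> 15}"
  define R where "R = VH - L"
  define R1 where "R1 = (\<Union>x\<in>L. nbrs x)"
  have "finite VH" using finite_ends by (simp add: VH_def)
  then have fin: "finite VH" "finite L" "finite R" by (simp_all add: L_def R_def)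
  \<comment> \<open>The degree formula gives at least 68 + 1 + 1, so a vertex of degree at most 15
    has only neighbours of degree at least 55.\<close>
  have sum70: "70 \<le> mdeg x + mdeg y" if "e \<in> E" "ends e = {x, y}" "x \<noteq> y" for e x y
  proof -
    have "e \<in> {f \<in> E. ends f = ends e}" using that(1) by simp
    then have "{f \<in> E. ends f = ends e} \<noteq> {}" by blast
    then have "0 < card {f \<in> E. ends f = ends e}" unfolding card_gt_0_iff using finite_edges by (rule conjI)
    then have "1 \<le> mult e" by (simp add: mult_def)
    then show ?thesis using mdeg_add_mdeg[OF that] deg_ge[OF that(1)] k_ge by linarith
  qed
  have nbr_high: "55 \<le> mdeg y" if x: "x \<in> L" and y: "y \<in> nbrs x" for x y
  proof -
    obtain e where "e \<in> E" "ends e = {x, y}" "x \<noteq> y" using y by (auto simp: nbrs_def)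
    then show ?thesis using sum70[of e x y] x by (auto simp: L_def)
  qed
  have R1R: "R1 \<subseteq> R"
  proof
    fix y assume "y \<in> R1"
    then obtain x where x: "x \<in> L" "y \<in> nbrs x" by (auto simp: R1_def)
    then have "y \<in> VH" by (auto simp: nbrs_def VH_def)
    then show "y \<in> R" using nbr_high[OF x] by (auto simp: R_def L_def)
  qed
  have L_le: "card L \<le> 2 * card R1"
  proof (cases "L = {}")
    case False
    have "card L < 2 * card R1" unfolding R1_def
    proof (rule low_card_lt[OF fin(2) False])
      show "L \<subseteq> (\<Union>e\<in>E. ends e)" by (auto simp: L_def VH_def)
      show "nbrs x \<inter> L = {}" if "x \<in> L" for x using R1R that by (auto simp: R1_def R_def)
    qed
    then show ?thesis by simp
  qed auto
  have "R \<noteq> {}"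
  proof -
    obtain e where e: "e \<in> E" using ne by blast
    obtain x y where xy: "ends e = {x, y}" "x \<noteq> y" using endsE[OF e] .
    then have "15 < mdeg x \<or> 15 < mdeg y" using sum70[OF e xy] by linarith
    moreover have "x \<in> VH" "y \<in> VH" using e xy by (auto simp: VH_def)
    ultimately show ?thesis by (auto simp: R_def L_def)
  qed
  then have ER: "card {e \<in> E. ends e \<subseteq> R} < 8 * card R" using edges_in_lt[OF mult3 fin(3)] by blast
  have "{e \<in> E. \<not> ends e \<subseteq> R} \<subseteq> (\<Union>x\<in>L. {e \<in> E. x \<in> ends e})" by (auto simp: R_def VH_def)
  then have "card {e \<in> E. \<not> ends e \<subseteq> R} \<le> card (\<Union>x\<in>L. {e \<in> E. x \<in> ends e})"
    using fin finite_edges by (intro card_mono) auto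
  also have "\<dots> \<le> (\<Sum>x\<in>L. mdeg x)" unfolding mdeg_def by (rule card_UN_le[OF fin(2)])
  also have "\<dots> \<le> 15 * card L" using sum_bounded_above[of L mdeg 15] by (simp add: L_def)
  finally have EL: "card {e \<in> E. \<not> ends e \<subseteq> R} \<le> 15 * card L" .
  have "(\<Sum>y\<in>R. mdeg y) = (\<Sum>y\<in>R. \<Sum>e\<in>E. if y \<in> ends e then 1 else 0)"
    unfolding mdeg_def using finite_E by (simp add: sum.If_cases Int_def)
  also have "\<dots> = (\<Sum>e\<in>E. \<Sum>y\<in>R. if y \<in> ends e then 1 else 0)" by (rule sum.swap)
  also have "\<dots> = (\<Sum>e\<in>E. card (R \<inter> ends e))"
    using fin by (simp add: sum.If_cases Int_def)
  also have "\<dots> \<le> (\<Sum>e\<in>E. if ends e \<subseteq> R then 2 else 1)"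
  proof (rule sum_mono)
    fix e assume e: "e \<in> E"
    then have fe: "finite (ends e)" using card_ends[OF e] by (metis card.infinite zero_neq_numeral)
    have "card (R \<inter> ends e) < 2" if "\<not> ends e \<subseteq> R"
    proof -
      have "R \<inter> ends e \<subset> ends e" using that by blast
      then show ?thesis using psubset_card_mono[OF fe] card_ends[OF e] by metis
    qed
    moreover have "card (R \<inter> ends e) \<le> 2" using card_mono[OF fe, of "R \<inter> ends e"] card_ends[OF e] by simp
    ultimately show "card (R \<inter> ends e) \<le> (if ends e \<subseteq> R then 2 else 1)"
      by (cases "ends e \<subseteq> R") simp_all
  qed
  also have "\<dots> = 2 * card {e \<in> E. ends e \<subseteq> R} + card {e \<in> E. \<not> ends e \<subseteq> R}"
    using finite_E by (simp add: sum.If_cases Int_def)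
  finally have upper: "(\<Sum>y\<in>R. mdeg y) \<le> 2 * card {e \<in> E. ends e \<subseteq> R} + card {e \<in> E. \<not> ends e \<subseteq> R}" .
  have finR1: "finite R1" using R1R fin finite_subset by blast
  have "55 * card R1 + 16 * card (R - R1) \<le> (\<Sum>y\<in>R1. mdeg y) + (\<Sum>y\<in>R - R1. mdeg y)"
  proof (rule add_mono)
    show "55 * card R1 \<le> (\<Sum>y\<in>R1. mdeg y)"
      using sum_bounded_below[of R1 55 mdeg] nbr_high by (auto simp: R1_def mult.commute)
    show "16 * card (R - R1) \<le> (\<Sum>y\<in>R - R1. mdeg y)"
    proof -
      have "16 \<le> mdeg y" if "y \<in> R - R1" for y using that by (auto simp: R_def L_def)
      then show ?thesis using sum_bounded_below[of "R - R1" 16 mdeg] by (simp add: mult.commute)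
    qed
  qed
  also have "\<dots> = (\<Sum>y\<in>R. mdeg y)" using sum.subset_diff[OF R1R fin(3), of mdeg] by simp
  finally have "55 * card R1 + 16 * card (R - R1) \<le> (\<Sum>y\<in>R. mdeg y)" .
  moreover have "card R = card R1 + card (R - R1)"
    using card_Diff_subset[OF finR1 R1R] card_mono[OF fin(3) R1R] by simp
  \<comment> \<open>The sum is at least \<open>16 * card R + 39 * card R1\<close>, but below
    \<open>16 * card R + 30 * card R1\<close>, since at most \<open>15 * card L\<close> edges leave
    \<open>R\<close>.\<close>
  ultimately show False using upper EL ER L_le by linarith
qed

end

section \<open>Edges of multiplicity at least four\<close>

context irreducible_line_multigraph
begin

lemma adj_sym: "adj e f \<Longrightarrow> adj f e"
  by (auto simp: adj_iff)

lemma adj_irrefl: "\<not> adj e e"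
  by (simp add: adj_iff)

text \<open>Degrees are at most \<open>k + 1\<close>, so the function in \<open>irreducible\<close>
  is at least the degree within \<open>S\<close> minus one.\<close>

lemma not_AT_deg_minus_one:
  assumes "S \<subseteq> E" "S \<noteq> {}"
    and "\<And>f. (\<And>e. e \<in> S \<Longrightarrow> int (deg S (induced adj S) e) \<le> f e + 1) \<Longrightarrow> is_AT S (induced adj S) f"
  shows False
proof -
  let ?f = "\<lambda>e. int (deg S (induced adj S) e) + int k - int (deg E adj e)"
  have "is_AT S (induced adj S) ?f"
  proof (rule assms(3))
    fix e assume "e \<in> S"
    then have "deg E adj e \<le> k + 1" using deg_le assms(1) by blast
    then show "int (deg S (induced adj S) e) \<le> ?f e + 1" by simp
  qed
  then show False using irreducible[OF assms(1,2), of ?f] by simp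
qed

text \<open>At v the edges of C1 are worst, then come those of A, then those of C2; at w the two
  halves of the class of e are exchanged.\<close>
lemma no_double_broom:
  assumes e: "e \<in> E" "ends e = {v, w}" "v \<noteq> w"
    and C: "C1 \<union> C2 \<subseteq> {f \<in> E. ends f = ends e}" "card C1 = 2" "card C2 = 2" "C1 \<inter> C2 = {}"
    and A: "A \<subseteq> {f \<in> E. v \<in> ends f \<and> ends f \<noteq> ends e}" "need e \<le> card A"
    and B: "B \<subseteq> {f \<in> E. w \<in> ends f \<and> ends f \<noteq> ends e}" "need e \<le> card B"
    and disj: "\<And>a b. a \<in> A \<Longrightarrow> b \<in> B \<Longrightarrow> ends a \<inter> ends b = {}"
  shows False
proof -
  define S where "S = C1 \<union> C2 \<union> A \<union> B"
  \<comment> \<open>One side consists of \<open>v\<close> and the far ends of \<open>B\<close>. The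
    far ends of \<open>A\<close> lie on the other side with \<open>w\<close>, because
    \<open>A\<close> and \<open>B\<close> share no ends.\<close>
  define X where "X = (\<Union>b\<in>B. ends b) \<union> {v} - {w}"
  define lev :: "'b \<Rightarrow> 'a \<Rightarrow> nat" where "lev = (\<lambda>u f. if f \<in> C1 then (if u = v then 0 else 2)
     else if f \<in> C2 then (if u = v then 2 else 0) else 1)"
  have SE: "S \<subseteq> E" using A(1) B(1) C(1) by (auto simp: S_def)
  have fin: "finite A" "finite B"
    using SE finite_E by (auto simp: S_def intro: finite_subset)
  have CD: "ends f = {v, w}" if "f \<in> C1 \<union> C2" for f using that C(1) e(2) by auto
  have AD: "ends f \<inter> {v, w} = {v}" "f \<notin> C1" "f \<notin> C2" "f \<in> E" "v \<in> ends f" if "f \<in> A" for f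
  proof -
    have f: "f \<in> E" "v \<in> ends f" "ends f \<noteq> {v, w}" using that A(1) e(2) by auto
    then have "w \<notin> ends f" using ends_eq[OF f(1,2)] e(3) by blast
    then show "ends f \<inter> {v, w} = {v}" using f(2) by blast
    show "f \<notin> C1" "f \<notin> C2" using CD f(3) by blast+
    show "f \<in> E" "v \<in> ends f" using f by blast+
  qed
  have BD: "ends f \<inter> {v, w} = {w}" "f \<notin> C1" "f \<notin> C2" "f \<in> E" "w \<in> ends f" if "f \<in> B" for f
  proof -
    have f: "f \<in> E" "w \<in> ends f" "ends f \<noteq> {v, w}" using that B(1) e(2) by auto
    then have "v \<notin> ends f" using ends_eq[OF f(1), of v] e(3) by blast
    then show "ends f \<inter> {v, w} = {w}" using f(2) by blast
    show "f \<notin> C1" "f \<notin> C2" using CD f(3) by blast+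
    show "f \<in> E" "w \<in> ends f" using f by blast+
  qed
  have "C1 \<noteq> {}" using C(2) by auto
  then have S_ne: "S \<noteq> {}" by (auto simp: S_def)
  have bip: "\<exists>x y. ends f = {x, y} \<and> x \<in> X \<and> y \<notin> X" if f: "f \<in> S" for f
  proof -
    consider "f \<in> C1 \<union> C2" | "f \<in> A" | "f \<in> B" using f by (auto simp: S_def)
    then show ?thesis
    proof cases
      case 1
      have "v \<in> X" "w \<notin> X" using e(3) by (auto simp: X_def)
      then show ?thesis using CD[OF 1] by (intro exI conjI)
    next
      case 2
      obtain z where z: "ends f = {v, z}" "v \<noteq> z" using other_end[OF AD(4,5)[OF 2]] .
      have "z \<notin> X" using z disj[OF 2] by (auto simp: X_def)
      moreover have "v \<in> X" using e(3) by (auto simp: X_def)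
      ultimately show ?thesis using z(1) by (intro exI conjI)
    next
      case 3
      obtain z where z: "ends f = {w, z}" "w \<noteq> z" using other_end[OF BD(4,5)[OF 3]] .
      then have "z \<in> X" using 3 by (auto simp: X_def)
      moreover have "w \<notin> X" by (auto simp: X_def)
      moreover have "ends f = {z, w}" using z(1) by auto
      ultimately show ?thesis by (intro exI conjI)
    qed
  qed
  have "\<exists>f\<in>S. card (worse S lev f) < need f"
    by (rule few_worse_than_need[OF SE S_ne bip])
  then obtain f where f: "f \<in> S" "card (worse S lev f) < need f" by blast
  have fE: "f \<in> E" using f(1) SE by blast
  have not_sub: "\<not> Z \<subseteq> worse S lev f" if "need f \<le> card Z" for Z
    using card_mono[OF finite_worse[OF SE], of Z lev f] that f(2) by linarith
  consider "f \<in> C1" | "f \<in> C2" "f \<notin> C1" | "f \<in> A" | "f \<in> B" using f(1) by (auto simp: S_def)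
  then show False
  proof cases
    case 1
    \<comment> \<open>At \<open>w\<close> an edge of \<open>C1\<close> has the highest level, so
      \<open>B\<close> is below it. The edges of \<open>C2\<close> share both ends with it and do
      not count.\<close>
    have "B \<subseteq> worse S lev f"
    proof
      fix b assume b: "b \<in> B"
      then have "ends f \<inter> ends b = {w}" using CD[of f] BD(1)[OF b] 1 by blast
      moreover have "lev w b < lev w f" using BD[OF b] 1 e(3) by (simp add: lev_def)
      ultimately show "b \<in> worse S lev f" using b by (auto simp: worse_def S_def)
    qed
    moreover have "need f = need e" using need_parallel[OF e(1) fE] CD[of f] 1 e(2) by simp
    ultimately show False using not_sub[of B] B(2) by simp
  next
    case 2
    have "A \<subseteq> worse S lev f"
    proof
      fix a assume a: "a \<in> A"
      then have "ends f \<inter> ends a = {v}" using CD[of f] AD(1)[OF a] 2 by blast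
      moreover have "lev v a < lev v f" using AD[OF a] 2 by (simp add: lev_def)
      ultimately show "a \<in> worse S lev f" using a by (auto simp: worse_def S_def)
    qed
    moreover have "need f = need e" using need_parallel[OF e(1) fE] CD[of f] 2 e(2) by simp
    ultimately show False using not_sub[of A] A(2) by simp
  next
    case 3
    have "C1 \<subseteq> worse S lev f"
    proof
      fix c assume c: "c \<in> C1"
      then have "ends f \<inter> ends c = {v}" using CD[of c] AD(1)[OF 3] by simp
      moreover have "lev v c < lev v f" using AD[OF 3] c by (simp add: lev_def)
      ultimately show "c \<in> worse S lev f" using c by (auto simp: worse_def S_def)
    qed
    then show False using not_sub[of C1] C(2) need_le[OF fE] by simp
  next
    case 4
    have "C2 \<subseteq> worse S lev f"
    proof
      fix c assume c: "c \<in> C2"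
      then have "ends f \<inter> ends c = {w}" using CD[of c] BD(1)[OF 4] by simp
      moreover have "c \<notin> C1" using c C(4) by blast
      then have "lev w c < lev w f" using BD[OF 4] c e(3) by (simp add: lev_def)
      ultimately show "c \<in> worse S lev f" using c by (auto simp: worse_def S_def)
    qed
    then show False using not_sub[of C2] C(3) need_le[OF fE] by simp
  qed
qed

text \<open>Otherwise e, its neighbours and nothing from Z would form too large a clique.\<close>
lemma nonadjacent_pair_avoiding:
  assumes e: "e \<in> E" "ends e = {v, w}" "v \<noteq> w" and Z: "finite Z" "card Z < need e"
  shows "\<exists>a b. a \<in> {f \<in> E. v \<in> ends f \<and> ends f \<noteq> ends e} - Z \<and>
    b \<in> {f \<in> E. w \<in> ends f \<and> ends f \<noteq> ends e} - Z \<and> ends a \<inter> ends b = {}"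
proof (rule ccontr)
  assume none: "\<not> ?thesis"
  have meet: "ends a \<inter> ends b \<noteq> {}" if "a \<in> E" "v \<in> ends a" "ends a \<noteq> ends e" "a \<notin> Z"
    "b \<in> E" "w \<in> ends b" "ends b \<noteq> ends e" "b \<notin> Z" for a b
  proof
    assume "ends a \<inter> ends b = {}"
    moreover have "a \<in> {f \<in> E. v \<in> ends f \<and> ends f \<noteq> ends e} - Z"
      "b \<in> {f \<in> E. w \<in> ends f \<and> ends f \<noteq> ends e} - Z" using that by simp_all
    ultimately show False using none by blast
  qed
  let ?N = "{f \<in> E. v \<in> ends f \<or> w \<in> ends f}"
  have "is_clique adj (?N - Z)"
    unfolding is_clique_def
  proof (intro ballI impI)
    fix f g assume fg: "f \<in> ?N - Z" "g \<in> ?N - Z" "f \<noteq> g"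
    have "ends f \<inter> ends g \<noteq> {}"
    proof (cases "ends f = ends e \<or> ends g = ends e")
      case True
      then show ?thesis using fg e(2) by auto
    next
      case False
      then show ?thesis using fg meet[of f g] meet[of g f] by blast
    qed
    then show "adj f g" using fg by (simp add: adj_iff)
  qed
  \<comment> \<open>The set \<open>?N\<close> has \<open>deg E adj e + 1\<close> elements, which is
    \<open>k + need e\<close>; removing fewer than \<open>need e\<close> leaves more than
    \<open>k\<close>.\<close>
  then have "card (?N - Z) \<le> k" by (intro clique_le) auto
  moreover have "card ?N \<le> card (?N - Z) + card Z"
    using card_mono[of "(?N - Z) \<union> Z" ?N] card_Un_le[of "?N - Z" Z] finite_E Z(1) by auto
  moreover have "?N = insert e {f \<in> E. adj e f}" using e by (auto simp: adj_iff)
  then have "card ?N = deg E adj e + 1" using finite_edges by (simp add: deg_def adj_irrefl)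
  ultimately show False using Z(2) by (simp add: need_def)
qed

text \<open>Four parallel edges serve every configuration: two are joined to a cycle, three to a
  path, and in the bipartite case they form two halves of a double broom.\<close>

lemma mult_le_3:
  assumes e: "e \<in> E"
  shows "mult e \<le> 3"
proof (rule ccontr)
  assume "\<not> mult e \<le> 3"
  then have "4 \<le> card {f \<in> E. ends f = ends e}" by (simp add: mult_def)
  then obtain C where C: "C \<subseteq> {f \<in> E. ends f = ends e}" "card C = 4" "finite C"
    by (rule obtain_subset_with_card_n)
  obtain cs where "set cs = C" "distinct cs" "length cs = 4"
    using finite_distinct_list[OF C(3)] C(2) distinct_card by metis
  then obtain c1 c2 c3 c4 where c: "C = {c1, c2, c3, c4}" "distinct [c1, c2, c3, c4]"
    by (auto simp: numeral_eq_Suc length_Suc_conv)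
  then have cE: "c \<in> E" "ends c = ends e" if "c \<in> {c1, c2, c3, c4}" for c using C(1) that by auto
  obtain v w where vw: "ends e = {v, w}" "v \<noteq> w" using endsE[OF e] .
  have pos: "0 < need e" using deg_ge[OF e] by (simp add: need_def)
  define A where "A = {f \<in> E. v \<in> ends f \<and> ends f \<noteq> ends e}"
  define B where "B = {f \<in> E. w \<in> ends f \<and> ends f \<noteq> ends e}"
  have pair: "\<exists>a b. a \<in> A - Z \<and> b \<in> B - Z \<and> ends a \<inter> ends b = {}" if "finite Z" "card Z < need e" for Z
    unfolding A_def B_def by (rule nonadjacent_pair_avoiding[OF e vw that])
  have broom: False if "A' \<subseteq> A" "B' \<subseteq> B" "need e \<le> card A'" "need e \<le> card B'"
      "\<And>a b. a \<in> A' \<Longrightarrow> b \<in> B' \<Longrightarrow> ends a \<inter> ends b = {}" for A' B'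
    using no_double_broom[OF e vw, of "{c1, c2}" "{c3, c4}" A' B'] that C(1) c by (auto simp: A_def B_def)
  obtain a1 b1 where ab1: "a1 \<in> A" "b1 \<in> B" "ends a1 \<inter> ends b1 = {}"
    using pair[of "{}"] pos by auto
  show False
  proof (cases "need e = 1")
    case True
    show False by (rule broom[of "{a1}" "{b1}"]) (use ab1 True in auto)
  next
    case False
    then have two: "need e = 2" using need_le[OF e] pos by linarith
    obtain a b where ab: "a \<in> A" "a \<noteq> a1" "b \<in> B" "ends a \<inter> ends b = {}"
      using pair[of "{a1}"] two by auto
    obtain a' b' where ab': "a' \<in> A" "b' \<in> B" "b' \<noteq> b1" "ends a' \<inter> ends b' = {}"
      using pair[of "{b1}"] two by auto
    \<comment> \<open>Besides the first pair there is one avoiding its \<open>a1\<close> and one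
      avoiding its \<open>b1\<close>. If neither is disjoint from the first pair, they share
      \<open>b1\<close> and \<open>a1\<close> with it respectively, and so are disjoint from each
      other.\<close>
    obtain a1 a2 b1 b2 where sel: "a1 \<in> A" "a2 \<in> A" "b1 \<in> B" "b2 \<in> B" "a1 \<noteq> a2" "b1 \<noteq> b2"
      "ends a1 \<inter> ends b1 = {}" "ends a2 \<inter> ends b2 = {}"
    proof (cases "b = b1")
      case False
      then show ?thesis using that[of a1 a b1 b] ab1 ab by simp
    next
      case b: True
      show ?thesis
      proof (cases "a' = a1")
        case True
        then show ?thesis using that[of a1 a b' b1] ab ab' ab1 b by simp
      next
        case False
        then show ?thesis using that[of a1 a' b1 b'] ab' ab1 by simp
      qed
    qed
    have AB: "f \<noteq> g" if "f \<in> A" "g \<in> B" for f g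
      using that vw ends_eq[of f v w] by (auto simp: A_def B_def)
    have adjAB: "adj f g \<longleftrightarrow> ends f \<inter> ends g \<noteq> {}" if "f \<in> A" "g \<in> B" for f g
      using that AB[OF that] by (auto simp: adj_iff A_def B_def)
    have adjA: "adj f g" if "f \<in> A" "g \<in> A" "f \<noteq> g" for f g
      using that by (auto simp: adj_iff A_def)
    have adjB: "adj f g" if "f \<in> B" "g \<in> B" "f \<noteq> g" for f g
      using that by (auto simp: adj_iff B_def)
    have cAB: "adj c f" "c \<noteq> f" if "c \<in> {c1, c2, c3, c4}" "f \<in> A \<union> B" for c f
    proof -
      have "ends c \<noteq> ends f" using cE(2)[OF that(1)] that(2) by (auto simp: A_def B_def)
      then show "c \<noteq> f" by blast
      then show "adj c f" using cE[OF that(1)] that(2) vw by (auto simp: A_def B_def adj_iff)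
    qed
    have adjC: "adj c c'" if "c \<in> {c1, c2, c3, c4}" "c' \<in> {c1, c2, c3, c4}" "c \<noteq> c'" for c c'
      using cE[OF that(1)] cE[OF that(2)] that(3) vw by (simp add: adj_iff)
    have dist: "distinct [c1, c2, c3, x1, x2, y1, y2]"
      if "x1 \<in> A" "x2 \<in> A" "x1 \<noteq> x2" "y1 \<in> B" "y2 \<in> B" "y1 \<noteq> y2" for x1 x2 y1 y2
    proof -
      have "\<forall>c\<in>{c1, c2, c3}. \<forall>f\<in>{x1, x2, y1, y2}. c \<noteq> f"
        using cAB(2) that by (intro ballI) blast
      moreover have "x1 \<noteq> y1" "x1 \<noteq> y2" "x2 \<noteq> y1" "x2 \<noteq> y2" using AB that by blast+
      ultimately show ?thesis using c(2) that(3,6) by simp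
    qed
    have P4: False
      if xy: "x1 \<in> A" "x2 \<in> A" "x1 \<noteq> x2" "y1 \<in> B" "y2 \<in> B" "y1 \<noteq> y2"
        and path: "adj x2 y1" "\<not> adj x1 y2" "\<not> adj x1 y1" "\<not> adj x2 y2" for x1 x2 y1 y2
    proof (rule not_AT_deg_minus_one)
      show "{c1, c2, c3, x1, x2, y1, y2} \<subseteq> E" using cE xy by (auto simp: A_def B_def)
      show "is_AT {c1, c2, c3, x1, x2, y1, y2} (induced adj {c1, c2, c3, x1, x2, y1, y2}) f"
        if f: "\<And>v. v \<in> {c1, c2, c3, x1, x2, y1, y2} \<Longrightarrow>
          int (deg {c1, c2, c3, x1, x2, y1, y2} (induced adj {c1, c2, c3, x1, x2, y1, y2}) v) \<le> f v + 1" for f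
      proof (rule is_AT_K3_join_P4[OF dist[OF xy] adj_sym adj_irrefl])
        show "\<forall>c\<in>{c1, c2, c3}. \<forall>u\<in>{x1, x2, y1, y2}. adj c u"
          using cAB(1) xy by (intro ballI) blast
        show "adj c1 c2" "adj c1 c3" "adj c2 c3" using c(2) by (auto intro!: adjC)
      qed (fact path adjA[OF xy(1-3)] adjB[OF xy(4-6)] | assumption | rule f, assumption)+
    qed simp
    have n11: "\<not> adj a1 b1" "\<not> adj a2 b2" using adjAB sel by auto
    \<comment> \<open>Given the two nonadjacent pairs, the four edges induce a 4-cycle, a path in
      one of two directions, or two separate adjacent pairs.\<close>
    consider "adj a1 b2" "adj a2 b1" | "\<not> adj a1 b2" "adj a2 b1" | "adj a1 b2" "\<not> adj a2 b1"
      | "\<not> adj a1 b2" "\<not> adj a2 b1" by blast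
    then show False
    proof cases
      case 1
      show False
      proof (rule not_AT_deg_minus_one)
        show "{c1, c2, a1, a2, b1, b2} \<subseteq> E" using cE sel by (auto simp: A_def B_def)
        show "is_AT {c1, c2, a1, a2, b1, b2} (induced adj {c1, c2, a1, a2, b1, b2}) f"
          if f: "\<And>v. v \<in> {c1, c2, a1, a2, b1, b2} \<Longrightarrow>
            int (deg {c1, c2, a1, a2, b1, b2} (induced adj {c1, c2, a1, a2, b1, b2}) v) \<le> f v + 1" for f
        proof (rule is_AT_K2_join_C4[OF _ adj_sym adj_irrefl])
          show "distinct [c1, c2, a1, a2, b1, b2]"
            using dist[OF sel(1,2,5) sel(3,4,6)] by simp
          show "\<forall>c\<in>{c1, c2}. \<forall>u\<in>{a1, a2, b1, b2}. adj c u"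
            using cAB(1) sel by (intro ballI) blast
          show "adj c1 c2" using c(2) by (auto intro!: adjC)
        qed (fact 1 n11 adjA[OF sel(1,2,5)] adjB[OF sel(3,4,6)] | assumption | rule f, assumption)+
      qed simp
    next
      case 2
      then show False using P4[of a1 a2 b1 b2] sel n11 by blast
    next
      case 3
      then show False using P4[of a2 a1 b2 b1] sel n11 by blast
    next
      case 4
      show False
        by (rule broom[of "{a1, a2}" "{b1, b2}"]) (use 4 sel two adjAB in auto)
    qed
  qed
qed

lemma no_edges: "E = {}"
  by (rule no_edges_of_mult_le[OF mult_le_3])

end

section \<open>Reducible subgraphs of line graphs\<close>

lemma card_le_clique_number:
  assumes "finite V" "K \<subseteq> V" "is_clique adj K"
  shows "card K \<le> clique_number V adj"
  unfolding clique_number_def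
proof (rule Max_ge)
  have "{card K |K. K \<subseteq> V \<and> is_clique adj K} \<subseteq> card ` Pow V" by auto
  then show "finite {card K |K. K \<subseteq> V \<and> is_clique adj K}"
    using assms(1) finite_subset by blast
qed (use assms in auto)

lemma deg_le_maxdeg: "finite V \<Longrightarrow> v \<in> V \<Longrightarrow> deg V adj v \<le> maxdeg V adj"
  by (auto simp: maxdeg_def)

text \<open>\<open>k\<close> is not tied to the maximum degree, so the result also applies to
  induced subgraphs with smaller degrees.\<close>

theorem line_graph_reducible_subgraph:
  assumes G: "graph V adj" "line_graph V adj" and "V \<noteq> {}"
    and clique: "\<And>K. K \<subseteq> V \<Longrightarrow> is_clique adj K \<Longrightarrow> card K \<le> k"
    and deg: "\<And>v. v \<in> V \<Longrightarrow> deg V adj v \<le> k + 1"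
    and k: "68 \<le> k"
  shows "\<exists>S\<subseteq>V. S \<noteq> {} \<and>
    (is_AT S (induced adj S) (\<lambda>v. int (deg S (induced adj S) v) + int k - int (deg V adj v)) \<or>
     is_KP S (induced adj S) (\<lambda>v. int (deg S (induced adj S) v) + int k - int (deg V adj v)))"
proof (rule ccontr)
  assume none: "\<not> ?thesis"
  obtain ends :: "'a \<Rightarrow> nat set" where ends: "\<forall>v\<in>V. card (ends v) = 2"
    "\<forall>u\<in>V. \<forall>v\<in>V. u \<noteq> v \<longrightarrow> (adj u v \<longleftrightarrow> ends u \<inter> ends v \<noteq> {})"
    using G(2) unfolding line_graph_def by blast
  interpret irreducible_line_multigraph V ends adj k
  proof
    show "finite V" using G(1) by (simp add: graph_def)
    show "card (ends e) = 2" if "e \<in> V" for e using ends(1) that by blast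
    show "adj e f \<longleftrightarrow> e \<in> V \<and> f \<in> V \<and> e \<noteq> f \<and> ends e \<inter> ends f \<noteq> {}" for e f
      using G(1) ends(2) unfolding graph_def by blast
    fix S and f :: "'a \<Rightarrow> int"
    assume S: "S \<subseteq> V" "S \<noteq> {}"
      and "\<And>e. f e = int (deg S (induced adj S) e) + int k - int (deg V adj e)"
    then have f: "f = (\<lambda>e. int (deg S (induced adj S) e) + int k - int (deg V adj e))" by blast
    show "\<not> is_AT S (induced adj S) f \<and> \<not> is_KP S (induced adj S) f"
      using none S unfolding f by blast
  qed (fact clique deg k)+
  show False using no_edges \<open>V \<noteq> {}\<close> by contradiction
qed

text \<open>Induced subgraphs inherit all hypotheses, so every nonempty \<open>U\<close> has a
  reducible part \<open>S\<close>. Painter wins on \<open>U - S\<close> by induction, and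
  \<open>painter_win_extend\<close> adds \<open>S\<close>.\<close>

lemma painter_win_line_graph:
  assumes G: "graph V adj" "line_graph V adj"
    and clique: "\<And>K. K \<subseteq> V \<Longrightarrow> is_clique adj K \<Longrightarrow> card K \<le> k"
    and deg: "\<And>v. v \<in> V \<Longrightarrow> deg V adj v \<le> k + 1"
    and k: "68 \<le> k"
  shows "painter_win adj V (\<lambda>_. k)"
proof -
  have finV: "finite V" and sym: "\<And>u v. adj u v \<Longrightarrow> adj v u" and irrefl: "\<And>u. \<not> adj u u"
    using G(1) unfolding graph_def by blast+
  have "painter_win adj U (\<lambda>_. k)" if "finite U" "U \<subseteq> V" for U
    using that
  proof (induction U rule: finite_psubset_induct)
    case (psubset U)
    show ?case
    proof (cases "U = {}")
      case True
      then show ?thesis by (rule painter_win.pw_done)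
    next
      case False
      have finU: "finite U" by (rule psubset.hyps)
      have degU: "deg U (induced adj U) v = card {u \<in> U. adj v u}" if "v \<in> U" for v
        using that unfolding deg_def induced_def by (intro arg_cong[where f = card]) auto
      have "\<exists>S\<subseteq>U. S \<noteq> {} \<and>
        (is_AT S (induced (induced adj U) S) (\<lambda>v. int (deg S (induced (induced adj U) S) v) + int k - int (deg U (induced adj U) v)) \<or>
         is_KP S (induced (induced adj U) S) (\<lambda>v. int (deg S (induced (induced adj U) S) v) + int k - int (deg U (induced adj U) v)))"
      proof (rule line_graph_reducible_subgraph[OF _ _ False _ _ k])
        show "graph U (induced adj U)"
          using finU sym irrefl by (auto simp: graph_def induced_def)
        obtain ends :: "'a \<Rightarrow> nat set" where ends: "\<forall>v\<in>V. card (ends v) = 2"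
          "\<forall>u\<in>V. \<forall>v\<in>V. u \<noteq> v \<longrightarrow> (adj u v \<longleftrightarrow> ends u \<inter> ends v \<noteq> {})"
          using G(2) unfolding line_graph_def by blast
        show "line_graph U (induced adj U)"
          unfolding line_graph_def
        proof (intro exI[of _ ends] conjI ballI impI)
          fix u v assume "u \<in> U" "v \<in> U" "u \<noteq> v"
          then show "induced adj U u v \<longleftrightarrow> ends u \<inter> ends v \<noteq> {}"
            using ends(2) psubset.prems by (auto simp: induced_def subset_iff)
        qed (use ends(1) psubset.prems in auto)
        show "card K \<le> k" if "K \<subseteq> U" "is_clique (induced adj U) K" for K
        proof (rule clique)
          show "K \<subseteq> V" using that(1) psubset.prems by blast
          show "is_clique adj K" using that(2) by (simp add: is_clique_def induced_def)
        qed
        show "deg U (induced adj U) v \<le> k + 1" if v: "v \<in> U" for v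
        proof -
          have "card {u \<in> U. adj v u} \<le> card {u \<in> V. adj v u}"
            using finV psubset.prems by (intro card_mono) auto
          moreover have "v \<in> V" using v psubset.prems by blast
          ultimately show ?thesis using deg[of v, unfolded deg_def] unfolding degU[OF v] by linarith
        qed
      qed
      then obtain S where S: "S \<subseteq> U" "S \<noteq> {}"
        and red0: "is_AT S (induced (induced adj U) S) (\<lambda>v. int (deg S (induced (induced adj U) S) v) + int k - int (deg U (induced adj U) v)) \<or>
         is_KP S (induced (induced adj U) S) (\<lambda>v. int (deg S (induced (induced adj U) S) v) + int k - int (deg U (induced adj U) v))"
        by blast
      have ind: "induced (induced adj U) S = induced adj S"
        using S(1) by (auto simp: induced_def fun_eq_iff)
      note red = red0[unfolded ind]
      show ?thesis
      proof (rule painter_win_extend[OF finU sym irrefl S(1) red])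
        fix v assume v: "v \<in> S"
        \<comment> \<open>The difference of the two degrees counts the neighbours in
          \<open>U - S\<close>, so the required bound on \<open>f\<close> holds with
          equality.\<close>
        have "{u \<in> U. adj v u} = {u \<in> S. adj v u} \<union> {u \<in> U - S. adj v u}" using S(1) by blast
        moreover have "finite {u \<in> S. adj v u}" "finite {u \<in> U - S. adj v u}"
          using finU finite_subset[OF S(1)] by auto
        ultimately have "card {u \<in> U. adj v u} = card {u \<in> S. adj v u} + card {u \<in> U - S. adj v u}"
          by (simp add: card_Un_disjoint disjoint_iff)
        moreover have "deg S (induced adj S) v = card {u \<in> S. adj v u}"
          using v unfolding deg_def induced_def by (intro arg_cong[where f = card]) auto
        moreover have "v \<in> U" using v S(1) by blast
        ultimately show "int (deg S (induced adj S) v) + int k - int (deg U (induced adj U) v) \<le>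
            int k - int (card {u \<in> U - S. adj v u})"
          by (simp add: degU)
      next
        show "painter_win adj (U - S) (\<lambda>_. k)"
          using S psubset.prems by (intro psubset.IH) auto
        show "0 < k" using k by simp
      qed
    qed
  qed
  then show ?thesis using finV by blast
qed

theorem mainTheorem16:
  fixes V :: "'a set" and adj :: "'a \<Rightarrow> 'a \<Rightarrow> bool"
  assumes "graph V adj" and "line_graph V adj"
  shows "(BK_free V adj \<and> clique_number V adj < maxdeg V adj \<longrightarrow> maxdeg V adj < 69)
       \<and> (maxdeg V adj \<ge> 69 \<longrightarrow>
            chi_OL V adj \<le> max (clique_number V adj) (maxdeg V adj - 1))"
proof (intro conjI impI)
  have finV: "finite V" using assms(1) by (simp add: graph_def)
  note deg = deg_le_maxdeg[OF finV] and clique = card_le_clique_number[OF finV]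
  {
    assume bk: "BK_free V adj \<and> clique_number V adj < maxdeg V adj"
    show "maxdeg V adj < 69"
    proof (rule ccontr)
      assume big: "\<not> maxdeg V adj < 69"
      \<comment> \<open>Cliques smaller than \<Delta> have size at most \<open>k\<close>, and with
        this \<open>k\<close> the function of the reducible subgraph is exactly
        \<open>fH\<close>.\<close>
      define k where "k = maxdeg V adj - 1"
      have k: "68 \<le> k" "k + 1 = maxdeg V adj" using big by (auto simp: k_def)
      have "V \<noteq> {}" using bk by (auto simp: BK_free_def connected_graph_def)
      moreover have "card K \<le> k" if "K \<subseteq> V" "is_clique adj K" for K
        using clique[OF that] bk k(2) by linarith
      moreover have "deg V adj v \<le> k + 1" if "v \<in> V" for v using deg[OF that] k(2) by simp
      ultimately obtain S where S: "S \<subseteq> V" "S \<noteq> {}"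
        "is_AT S (induced adj S) (\<lambda>v. int (deg S (induced adj S) v) + int k - int (deg V adj v)) \<or>
         is_KP S (induced adj S) (\<lambda>v. int (deg S (induced adj S) v) + int k - int (deg V adj v))"
        using line_graph_reducible_subgraph[OF assms, of k] k(1) by blast
      have "(\<lambda>v. int (deg S (induced adj S) v) + int k - int (deg V adj v)) = fH V adj S"
        using k(2) by (auto simp: fH_def fun_eq_iff)
      then show False using bk S unfolding BK_free_def by metis
    qed
  }
  {
    assume big: "maxdeg V adj \<ge> 69"
    \<comment> \<open>The maximum provides the clique bound and the degree bound at once.\<close>
    define k where "k = max (clique_number V adj) (maxdeg V adj - 1)"
    have k: "68 \<le> k" using big by (auto simp: k_def)
    have "painter_win adj V (\<lambda>_. k)"
    proof (rule painter_win_line_graph[OF assms _ _ k])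
      show "card K \<le> k" if "K \<subseteq> V" "is_clique adj K" for K
        using clique[OF that] by (simp add: k_def)
      show "deg V adj v \<le> k + 1" if "v \<in> V" for v
      proof -
        have "maxdeg V adj - 1 \<le> k" by (simp add: k_def)
        then show ?thesis using deg[OF that, of adj] by linarith
      qed
    qed
    then have "1 \<le> k \<and> paintable V adj (\<lambda>_. k)" using k by (simp add: paintable_def)
    then show "chi_OL V adj \<le> max (clique_number V adj) (maxdeg V adj - 1)"
      unfolding chi_OL_def k_def[symmetric] by (rule Least_le)
  }
qed

end
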